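(* Let $C$ be a compact and stable convex subset of a locally convex Hausdorff vector space $X$, and let $d$ be a distance on $\mathrm{Ext}\,C$ continuous on $\mathrm{Ext}\,C\times \mathrm{Ext}\,C$ with respect to the natural topology (the one induced by $X$). Let $r:\mathcal{P}(\mathrm{Ext}\,C)\to C$ be the resultant map. Then for any $p\in[1,\infty)$, $D_p$ is the quotient pseudo-distance, by the surjection $r$, of the Wasserstein-$p$ distance $W_p$ on $\mathcal{P}(\mathrm{Ext}\,C)$ associated with $d$; that is, for all $x,y\in C$, $$d_{*p}(x,y)=\inf_{\mu\in r^{-1}(\{x\})}\ \inf_{\nu\in r^{-1}(\{y\})}W_p(\mu,\nu),$$ and $D_p$ is the largest pseudo-distance on $C$ that is no more than this function $d_{*p}$.
   Context: $\mathrm{Ext}\,C$ is the set of extreme points of $C$. A convex set $C$ is stable when the midpoint map $C\times C\to C$, $(x,y)\mapsto (x+y)/2$, is open (relative topologies). $X^*$ is the set of continuous real linear forms on $X$; $\mathcal{P}(E)$ is the set of Radon probability measures on $E$. A pseudo-distance is a function satisfying all axioms of a distance except possibly separation of points. The resultant map $r$ sends $\mu\in\mathcal{P}(\mathrm{Ext}\,C)$ to its barycenter, the unique $x\in C$ with $\int f\,d\mu=f(x)$ for all $f\in X^*$; under the assumptions, $r$ is well-defined and surjective, and $(\mathrm{Ext}\,C,d)$ is a compact metric space. For $x,y\in C$, $\mathcal{P}_{(x,y)}$ is the set of $\pi\in\mathcal{P}(\mathrm{Ext}\,C\times \mathrm{Ext}\,C)$ with $\iint f(z)\,d\pi(z,z_*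 )=f(x)$ and $\iint f(z_* )\,d\pi(z,z_* )=f(y)$ for all $f\in X^*$. The $p$-convex roof extension of $d$ is $$d_{*p}(x,y)=\Big(\inf_{\pi\in\mathcal{P}_{(x,y)}}\iint d(z,z_* )^p\,d\pi(z,z_* )\Big)^{1/p},$$ and $$D_p(x,y)=\inf\Big\{\sum_{j=1}^N d_{*p}(z_j,z_{j+1}):\ N\ge 1,\ z_1=x,\ z_{N+1}=y,\ z_j\in C\Big\}.$$ $W_p(\mu,\nu)=\big(\inf_\pi\iint d^p\,d\pi\big)^{1/p}$, the infimum being over Radon probability measures $\pi$ on $\mathrm{Ext}\,C\times \mathrm{Ext}\,C$ with marginals $\mu$ and $\nu$. *)

theory Defs
  imports "HOL-Probability.Probability"
begin

text \<open>
  Not necessarily Hausdorff; the Hausdorff property is expressed by adding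
  the class \<^class>\<open>t2_space\<close>. Convexity of \<open>V\<close> is unfolded because \<open>convex\<close> cannot be
  used inside a class specification.
\<close>

class locally_convex_space = real_vector + topological_ab_group_add +
  assumes tendsto_scaleR_Pair:
    "LIM x (nhds (a::real) \<times>\<^sub>F nhds b). fst x *\<^sub>R snd x :> nhds (a *\<^sub>R b)"
  and convex_nhds_0:
    "open U \<Longrightarrow> 0 \<in> U \<Longrightarrow> \<exists>V. open V \<and> 0 \<in> V \<and> V \<subseteq> U \<and>
       (\<forall>x\<in>V. \<forall>y\<in>V. \<forall>u\<ge>0. \<forall>v\<ge>0. u + v = 1 \<longrightarrow> u *\<^sub>R x + v *\<^sub>R y \<in> V)"

definition continuous_dual :: "('a::{real_vector,topological_space} \<Rightarrow> real) set" where
  "continuous_dual = {f. linear f \<and> continuous_on UNIV f}"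

definition Ext :: "'a::real_vector set \<Rightarrow> 'a set" where
  "Ext C = {x. x extreme_point_of C}"

definition stable_convex :: "'a::{real_vector,topological_space} set \<Rightarrow> bool" where
  "stable_convex C \<longleftrightarrow>
     convex C \<and> open_map (top_of_set (C \<times> C)) (top_of_set C) (\<lambda>(x, y). midpoint x y)"

text \<open>
  A measure on a subset \<open>E\<close> lives on the Borel sigma-algebra of the subspace
  topology of \<open>E\<close>. On products, \<open>borel\<close> is the Borel sigma-algebra of the product
  topology, which may be larger than \<open>borel \<Otimes>\<^sub>M borel\<close> because the
  ambient space need not be second countable.
\<close>

definition radon_prob :: "'a::t2_space set \<Rightarrow> 'a measure set" where
  "radon_prob E = {M. sets M = sets (restrict_space borel E) \<and> prob_space M \<and>
     (\<forall>A\<in>sets M. emeasure M A = (SUP K\<in>{K. K \<subseteq> A \<and> compact K}. emeasure M K))}"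

definition resultant :: "'a::{real_vector,t2_space} set \<Rightarrow> 'a measure \<Rightarrow> 'a" where
  "resultant C \<mu> = (THE x. x \<in> C \<and> (\<forall>f\<in>continuous_dual. (\<integral>z. f z \<partial>\<mu>) = f x))"

definition resultant_fibre :: "'a::{real_vector,t2_space} set \<Rightarrow> 'a \<Rightarrow> 'a measure set" where
  "resultant_fibre C x = {\<mu> \<in> radon_prob (Ext C). resultant C \<mu> = x}"

definition bary_plans ::
    "'a::{real_vector,t2_space} set \<Rightarrow> 'a \<Rightarrow> 'a \<Rightarrow> ('a \<times> 'a) measure set" where
  "bary_plans C x y = {\<pi> \<in> radon_prob (Ext C \<times> Ext C).
     \<forall>f\<in>continuous_dual. (\<integral>w. f (fst w) \<partial>\<pi>) = f x \<and> (\<integral>w. f (snd w) \<partial>\<pi>) = f y}"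

text \<open>
  The infima below are infima of sets of reals. These are bounded below by 0, and for \<open>C\<close>
  compact and stable, \<open>d\<close> a continuous distance on \<open>Ext C\<close> and points of \<open>C\<close>
  (respectively Radon probability measures on \<open>Ext C\<close>) they are nonempty.
\<close>

definition convex_roof ::
    "'a::{real_vector,t2_space} set \<Rightarrow> ('a \<Rightarrow> 'a \<Rightarrow> real) \<Rightarrow> real \<Rightarrow> 'a \<Rightarrow> 'a \<Rightarrow> real" where
  "convex_roof C d p x y =
     (INF \<pi>\<in>bary_plans C x y. \<integral>w. d (fst w) (snd w) powr p \<partial>\<pi>) powr (1 / p)"

definition chain_distance ::
    "'a::{real_vector,t2_space} set \<Rightarrow> ('a \<Rightarrow> 'a \<Rightarrow> real) \<Rightarrow> real \<Rightarrow> 'a \<Rightarrow> 'a \<Rightarrow> real" where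
  "chain_distance C d p x y =
     Inf {(\<Sum>j=1..N. convex_roof C d p (z j) (z (j + 1))) | (N::nat) (z::nat \<Rightarrow> 'a).
       N \<ge> 1 \<and> z 1 = x \<and> z (N + 1) = y \<and> (\<forall>j\<in>{1..N + 1}. z j \<in> C)}"

definition couplings ::
    "'a::t2_space set \<Rightarrow> 'a measure \<Rightarrow> 'a measure \<Rightarrow> ('a \<times> 'a) measure set" where
  "couplings E \<mu> \<nu> = {\<pi> \<in> radon_prob (E \<times> E).
     distr \<pi> (restrict_space borel E) fst = \<mu> \<and> distr \<pi> (restrict_space borel E) snd = \<nu>}"

definition wasserstein ::
    "'a::t2_space set \<Rightarrow> ('a \<Rightarrow> 'a \<Rightarrow> real) \<Rightarrow> real \<Rightarrow> 'a measure \<Rightarrow> 'a measure \<Rightarrow> real" where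
  "wasserstein E d p \<mu> \<nu> =
     (INF \<pi>\<in>couplings E \<mu> \<nu>. \<integral>w. d (fst w) (snd w) powr p \<partial>\<pi>) powr (1 / p)"

definition pseudo_distance_on :: "'a set \<Rightarrow> ('a \<Rightarrow> 'a \<Rightarrow> real) \<Rightarrow> bool" where
  "pseudo_distance_on C \<delta> \<longleftrightarrow>
     (\<forall>x\<in>C. \<forall>y\<in>C. 0 \<le> \<delta> x y \<and> \<delta> x y = \<delta> y x) \<and>
     (\<forall>x\<in>C. \<delta> x x = 0) \<and>
     (\<forall>x\<in>C. \<forall>y\<in>C. \<forall>z\<in>C. \<delta> x z \<le> \<delta> x y + \<delta> y z)"

definition largest_pseudo_distance_below ::
    "'a set \<Rightarrow> ('a \<Rightarrow> 'a \<Rightarrow> real) \<Rightarrow> ('a \<Rightarrow> 'a \<Rightarrow> real) \<Rightarrow> bool" where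
  "largest_pseudo_distance_below C c D \<longleftrightarrow>
     pseudo_distance_on C D \<and> (\<forall>x\<in>C. \<forall>y\<in>C. D x y \<le> c x y) \<and>
     (\<forall>\<delta>. pseudo_distance_on C \<delta> \<and> (\<forall>x\<in>C. \<forall>y\<in>C. \<delta> x y \<le> c x y) \<longrightarrow>
        (\<forall>x\<in>C. \<forall>y\<in>C. \<delta> x y \<le> D x y))"

end

theory Submission
  imports Defs
begin

text \<open>
  A plan lies in \<open>bary_plans C x y\<close> exactly when its marginals have resultants \<open>x\<close> and \<open>y\<close>, so
  the infimum defining the convex roof splits into an infimum over the marginals and one over their
  couplings. Symmetry and vanishing on the diagonal come from pushing plans forward under the swap
  and a representing measure under the diagonal map, and the infimum over chains of such a function
  is the largest pseudo-distance below it.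

  The substance lies in the resultant map. Stability makes \<open>Ext C\<close> closed: a limit of extreme points
  that is a proper midpoint would have a whole neighbourhood of proper midpoints. A representing
  measure of \<open>x \<in> C\<close> comes from a Hahn-Banach extension, below the upper envelope at \<open>x\<close>, to
  all bounded functions on \<open>Ext C\<close>; the resulting finitely additive content is countably additive on
  the algebra of sets regular for it, which generates the Borel sets since \<open>Ext C\<close> is compact and
  metrizable.
\<close>

section \<open>Hahn-Banach\<close>

text \<open>Neither \<open>X\<close> nor \<open>C\<close> is assumed metrizable; the measure theory
  rests on the extreme boundary alone. Once \<open>Ext C\<close> is compact, \<open>d\<close>
  exhausts its relatively open subsets by compact sets, so that every Borel probability on
  \<open>Ext C\<close>, or on its square, is Radon.

  The Hahn-Banach functional is taken on all bounded functions, not only on continuous ones, so that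
  it has values on indicators and yields a content at once. The price is that this content may be
  badly behaved at the boundary of an open set; sublevel sets of continuous functions avoid this at
  all but countably many levels.

  Two further obstacles shape the second half. Plans live on the Borel sets of the product topology,
  so a product measure becomes a coupling only after these sets are shown to be product measurable.
  And no optimal plan is selected: roots of infima are compared through p-th powers, plan by
  plan.\<close>

definition sublinear :: "('v::real_vector \<Rightarrow> real) \<Rightarrow> bool" where
  "sublinear q \<longleftrightarrow> (\<forall>x y. q (x + y) \<le> q x + q y) \<and> (\<forall>t>0. \<forall>x. q (t *\<^sub>R x) \<le> t * q x)"

lemma sublinear_add: "sublinear q \<Longrightarrow> q (x + y) \<le> q x + q y"
  by (simp add: sublinear_def)

lemma sublinear_zero:
  assumes "sublinear q"
  shows "q 0 = 0"
proof -
  have "q 0 \<le> 2 * q 0" "q 0 \<le> (1/2) * q 0"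
    using assms unfolding sublinear_def by (metis scaleR_zero_right zero_less_numeral,
      metis scaleR_zero_right half_gt_zero_iff zero_less_one)
  then show ?thesis by linarith
qed

text \<open>The reverse inequality is the defining one for \<open>inverse t\<close>, applied to
  \<open>t *\<^sub>R x\<close>.\<close>

lemma sublinear_scaleR:
  assumes "sublinear q" "0 \<le> t"
  shows "q (t *\<^sub>R x) = t * q x"
proof (cases "t = 0")
  case True
  then show ?thesis using sublinear_zero[OF assms(1)] by simp
next
  case False
  then have t: "t > 0" using assms by simp
  then have "q (inverse t *\<^sub>R (t *\<^sub>R x)) \<le> inverse t * q (t *\<^sub>R x)"
    using assms(1) unfolding sublinear_def by (meson inverse_positive_iff_positive)
  then have "t * q x \<le> q (t *\<^sub>R x)"
    using t by (simp add: field_simps)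
  moreover have "q (t *\<^sub>R x) \<le> t * q x"
    using assms(1) t unfolding sublinear_def by blast
  ultimately show ?thesis by simp
qed

lemma sublinear_ge_minus:
  assumes "sublinear q"
  shows "- q (- x) \<le> q x"
  using sublinear_add[OF assms, of x "- x"] sublinear_zero[OF assms] by simp

lemma sublinear_Inf_chain:
  assumes Q: "Q \<noteq> {}" "\<And>q. q \<in> Q \<Longrightarrow> sublinear q"
    and chain: "\<And>q q'. q \<in> Q \<Longrightarrow> q' \<in> Q \<Longrightarrow> q \<le> q' \<or> q' \<le> q"
  shows "\<exists>u. sublinear u \<and> (\<forall>q\<in>Q. u \<le> q)"
proof -
  define u where "u = (\<lambda>x. INF q\<in>Q. q x)"
  obtain q0 where q0: "q0 \<in> Q" using Q by blast
  \<comment> \<open>The bound must not depend on \<open>q\<close>. Either \<open>q\<close> lies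
    above the fixed \<open>q0\<close>, or it lies below, and then q x \<ge> -q (-x) \<ge> -q0
    (-x).\<close>
  have low: "- max (q0 (- x)) (- q0 x) \<le> q x" if "q \<in> Q" for q x
    using chain[OF q0 that]
  proof
    assume "q0 \<le> q"
    then have "q0 x \<le> q x" by (simp add: le_fun_def)
    then show ?thesis by linarith
  next
    assume "q \<le> q0"
    then have "- q0 (- x) \<le> - q (- x)" by (simp add: le_fun_def)
    also have "\<dots> \<le> q x" by (rule sublinear_ge_minus[OF Q(2)[OF that]])
    finally show ?thesis by linarith
  qed
  have bdd: "bdd_below ((\<lambda>q. q x) ` Q)" for x
    using low by (intro bdd_belowI2) blast
  have le: "u x \<le> q x" if "q \<in> Q" for q x
    unfolding u_def by (rule cINF_lower[OF bdd that])
  have ge: "c \<le> u x" if "\<And>q. q \<in> Q \<Longrightarrow> c \<le> q x" for c x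
    unfolding u_def using Q(1) that by (rule cINF_greatest)
  have "u (x + y) \<le> u x + u y" for x y
  proof -
    have *: "u (x + y) \<le> q x + q' y" if "q \<in> Q" "q' \<in> Q" for q q'
    proof -
      \<comment> \<open>In a chain one of the two members lies below both, so the subadditivity of a
        single \<open>r\<close> serves independent choices of \<open>q\<close> and
        \<open>q'\<close>.\<close>
      obtain r where r: "r \<in> Q" "r \<le> q" "r \<le> q'"
        using chain[OF \<open>q \<in> Q\<close> \<open>q' \<in> Q\<close>] \<open>q \<in> Q\<close> \<open>q' \<in> Q\<close> by (metis order_refl)
      have "u (x + y) \<le> r (x + y)" by (rule le[OF r(1)])
      also have "\<dots> \<le> r x + r y" by (rule sublinear_add[OF Q(2)[OF r(1)]])
      also have "\<dots> \<le> q x + q' y" using r by (intro add_mono) (auto simp: le_fun_def)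
      finally show ?thesis .
    qed
    have "u (x + y) - q x \<le> u y" if "q \<in> Q" for q
      using *[OF that] by (intro ge) (simp add: diff_le_eq add.commute)
    then have "u (x + y) - u y \<le> u x"
      by (intro ge) (simp add: diff_le_eq le_diff_eq algebra_simps)
    then show ?thesis by simp
  qed
  moreover have "u (t *\<^sub>R x) \<le> t * u x" if "t > 0" for t x
  proof -
    have "u (t *\<^sub>R x) / t \<le> u x"
    proof (rule ge)
      fix q assume q: "q \<in> Q"
      show "u (t *\<^sub>R x) / t \<le> q x"
        using le[OF q, of "t *\<^sub>R x"] sublinear_scaleR[OF Q(2)[OF q], of t x] that
        by (simp add: field_simps)
    qed
    then show ?thesis using that by (simp add: field_simps)
  qed
  ultimately show ?thesis
    using le unfolding sublinear_def by (intro exI[of _ u]) (auto simp: le_fun_def)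
qed

text \<open>Applied to a minimal sublinear functional \<open>q\<close>, this forces \<open>q\<close> to be additive.\<close>

lemma sublinear_lower:
  assumes q: "sublinear q"
  obtains u where "sublinear u" "u \<le> q" "\<And>x. u x \<le> q (x + a) - q a"
proof -
  \<comment> \<open>The value t = 0 gives \<open>u \<le> q\<close> and t = 1 gives the last
    property. Admitting every t \<ge> 0 makes the family invariant under scaling and under adding
    parameters, hence \<open>u\<close> sublinear.\<close>
  define u where "u = (\<lambda>x. INF t\<in>{0..}. q (x + t *\<^sub>R a) - t * q a)"
  have bdd: "bdd_below ((\<lambda>t. q (x + t *\<^sub>R a) - t * q a) ` {0..})" for x
  proof (rule bdd_belowI2)
    fix t :: real assume "t \<in> {0..}"
    then have "t * q a = q (t *\<^sub>R a)" by (simp add: sublinear_scaleR[OF q])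
    also have "\<dots> \<le> q (x + t *\<^sub>R a) + q (- x)"
      using sublinear_add[OF q, of "x + t *\<^sub>R a" "- x"] by simp
    finally show "- q (- x) \<le> q (x + t *\<^sub>R a) - t * q a" by simp
  qed
  have le: "u x \<le> q (x + t *\<^sub>R a) - t * q a" if "0 \<le> t" for t x
    unfolding u_def using that by (intro cINF_lower[OF bdd]) simp
  have ge: "c \<le> u x" if "\<And>t. 0 \<le> t \<Longrightarrow> c \<le> q (x + t *\<^sub>R a) - t * q a" for c x
    unfolding u_def using that by (intro cINF_greatest) auto
  have "u (x + y) \<le> u x + u y" for x y
  proof -
    have *: "u (x + y) \<le> (q (x + t *\<^sub>R a) - t * q a) + (q (y + s *\<^sub>R a) - s * q a)"
      if "0 \<le> t" "0 \<le> s" for t s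
    proof -
      have "u (x + y) \<le> q ((x + y) + (t + s) *\<^sub>R a) - (t + s) * q a"
        by (rule le) (use that in simp)
      also have "(x + y) + (t + s) *\<^sub>R a = (x + t *\<^sub>R a) + (y + s *\<^sub>R a)"
        by (simp add: algebra_simps)
      finally show ?thesis
        using sublinear_add[OF q, of "x + t *\<^sub>R a" "y + s *\<^sub>R a"] by (simp add: algebra_simps)
    qed
    have "u (x + y) - (q (x + t *\<^sub>R a) - t * q a) \<le> u y" if "0 \<le> t" for t
      using *[OF that] by (intro ge) (simp add: algebra_simps)
    then have "u (x + y) - u y \<le> u x"
      by (intro ge) (simp add: algebra_simps)
    then show ?thesis by simp
  qed
  moreover have "u (s *\<^sub>R x) \<le> s * u x" if "s > 0" for s x
  proof -
    have "u (s *\<^sub>R x) / s \<le> u x"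
    proof (rule ge)
      fix t :: real assume t: "0 \<le> t"
      have "u (s *\<^sub>R x) \<le> q (s *\<^sub>R x + (s * t) *\<^sub>R a) - (s * t) * q a"
        by (rule le) (use t that in simp)
      also have "s *\<^sub>R x + (s * t) *\<^sub>R a = s *\<^sub>R (x + t *\<^sub>R a)"
        by (simp add: algebra_simps)
      also have "q (s *\<^sub>R (x + t *\<^sub>R a)) = s * q (x + t *\<^sub>R a)"
        by (rule sublinear_scaleR[OF q]) (use that in simp)
      finally show "u (s *\<^sub>R x) / s \<le> q (x + t *\<^sub>R a) - t * q a"
        using that by (simp add: field_simps)
    qed
    then show ?thesis using that by (simp add: field_simps)
  qed
  ultimately have "sublinear u" by (auto simp: sublinear_def)
  moreover have "u \<le> q" using le[of 0] by (simp add: le_fun_def)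
  moreover have "u x \<le> q (x + a) - q a" for x using le[of 1 x] by simp
  ultimately show ?thesis by (rule that)
qed

text \<open>A minimal sublinear functional is linear, by \<open>sublinear_lower\<close>. Zorn is
  applied below \<open>p'\<close> instead of \<open>p\<close>: since p' (-a) \<le> -p a, every
  linear functional below \<open>p'\<close> already satisfies f a \<ge> p a. The order is reversed
  so that the maximal element is a minimal functional.\<close>

lemma Hahn_Banach_sublinear:
  fixes p :: "'v::real_vector \<Rightarrow> real"
  assumes p: "sublinear p"
  obtains f where "linear f" "\<And>x. f x \<le> p x" "f a = p a"
proof -
  obtain p' where p': "sublinear p'" "p' \<le> p" "\<And>x. p' x \<le> p (x + a) - p a"
    using sublinear_lower[OF p, of a] by blast
  define A where "A = {q. sublinear q \<and> q \<le> p'}"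
  have "\<exists>m\<in>A. \<forall>q\<in>A. q \<le> m \<longrightarrow> q = m"
  proof (rule predicate_Zorn)
    show "partial_order_on A (relation_of (\<lambda>q q'. q' \<le> q) A)"
      by (rule partial_order_on_relation_ofI) auto
    fix Q assume Q: "Q \<in> Chains (relation_of (\<lambda>q q'. q' \<le> q) A)"
    then have QA: "Q \<subseteq> A" by (auto simp: Chains_def relation_of_def)
    show "\<exists>u\<in>A. \<forall>q\<in>Q. u \<le> q"
    proof (cases "Q = {}")
      case True
      then show ?thesis using p' by (auto simp: A_def)
    next
      case False
      have "\<exists>u. sublinear u \<and> (\<forall>q\<in>Q. u \<le> q)"
        by (rule sublinear_Inf_chain)
           (use Q QA False in \<open>auto simp: A_def Chains_def relation_of_def\<close>)
      then obtain u where u: "sublinear u" "\<And>q. q \<in> Q \<Longrightarrow> u \<le> q" by blast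
      obtain q where "q \<in> Q" using False by blast
      then have "u \<le> p'" using u(2) QA by (force simp: A_def intro: order_trans)
      then show ?thesis using u by (auto simp: A_def)
    qed
  qed
  then obtain f where f: "sublinear f" "f \<le> p'" "\<And>q. sublinear q \<Longrightarrow> q \<le> p' \<Longrightarrow> q \<le> f \<Longrightarrow> q = f"
    by (auto simp: A_def)
  have add: "f (x + y) = f x + f y" for x y
  proof (rule antisym)
    obtain u where u: "sublinear u" "u \<le> f" "\<And>x. u x \<le> f (x + y) - f y"
      using sublinear_lower[OF f(1), of y] by blast
    then have "u = f" using f by (meson order_trans)
    then show "f x + f y \<le> f (x + y)" using u(3)[of x] by simp
  qed (rule sublinear_add[OF f(1)])
  have neg: "f (- x) = - f x" for x
    using add[of x "- x"] sublinear_zero[OF f(1)] by simp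
  have scale: "f (t *\<^sub>R x) = t * f x" for t x
  proof (cases "0 \<le> t")
    case False
    then have "f (- (t *\<^sub>R x)) = (- t) * f x"
      using sublinear_scaleR[OF f(1), of "- t" x] by simp
    then show ?thesis by (simp add: neg)
  qed (rule sublinear_scaleR[OF f(1)])
  have "f (- a) \<le> - p a"
    using p'(3)[of "- a"] f(2) sublinear_zero[OF p] by (auto simp: le_fun_def intro: order_trans)
  then have "p a \<le> f a" by (simp add: neg)
  moreover have le: "f x \<le> p x" for x
    using f(2) p'(2) by (auto simp: le_fun_def intro: order_trans)
  ultimately have "f a = p a" by (simp add: antisym)
  with le show ?thesis
    by (intro that[of f] linearI) (auto simp: add scale)
qed

section \<open>Continuous linear forms separate points\<close>

lemma tendsto_scaleR_locally_convex:
  fixes g :: "'b \<Rightarrow> 'a::locally_convex_space"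
  assumes "(f \<longlongrightarrow> a) F" "(g \<longlongrightarrow> b) F"
  shows "((\<lambda>x. f x *\<^sub>R g x) \<longlongrightarrow> a *\<^sub>R b) F"
  using filterlim_compose[OF tendsto_scaleR_Pair filterlim_Pair[OF assms]] by simp

lemma linear_continuous_if_le_on_neighbourhood:
  fixes f :: "'a::locally_convex_space \<Rightarrow> real"
  assumes f: "linear f" and V: "open V" "0 \<in> V" "\<And>x. x \<in> V \<Longrightarrow> f x \<le> 1"
  shows "continuous_on UNIV f"
  unfolding continuous_on_def
proof (intro ballI tendstoI)
  fix x :: 'a and e :: real assume e: "0 < e"
  \<comment> \<open>\<open>V\<close> need not be symmetric, so both differences are scaled into it.
    The factor 2/e bounds |f y - f x| by e/2, which leaves room for the strict inequality.\<close>
  have "((\<lambda>y. (2 / e) *\<^sub>R (y - x)) \<longlongrightarrow> (2 / e) *\<^sub>R (x - x)) (at x within UNIV)"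
    by (intro tendsto_scaleR_locally_convex tendsto_intros)
  moreover have "((\<lambda>y. (2 / e) *\<^sub>R (x - y)) \<longlongrightarrow> (2 / e) *\<^sub>R (x - x)) (at x within UNIV)"
    by (intro tendsto_scaleR_locally_convex tendsto_intros)
  ultimately have "eventually (\<lambda>y. (2 / e) *\<^sub>R (y - x) \<in> V \<and> (2 / e) *\<^sub>R (x - y) \<in> V) (at x within UNIV)"
    using V by (auto simp: tendsto_def eventually_conj_iff)
  then show "eventually (\<lambda>y. dist (f y) (f x) < e) (at x within UNIV)"
  proof eventually_elim
    case (elim y)
    then have "(2 / e) * (f y - f x) \<le> 1" "(2 / e) * (f x - f y) \<le> 1"
      using V(3)[of "(2 / e) *\<^sub>R (y - x)"] V(3)[of "(2 / e) *\<^sub>R (x - y)"]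
      by (simp_all add: linear_cmul[OF f] linear_diff[OF f])
    then show ?case using e by (simp add: dist_real_def field_simps abs_if)
  qed
qed

text \<open>\<open>g\<close> is the Minkowski gauge of a convex neighbourhood \<open>V\<close> of 0
  that misses \<open>a = x - y\<close>. A linear form below \<open>g\<close> that agrees with it at
  \<open>a\<close> is at least 1 at \<open>a\<close>, hence nonzero there, and at most 1 on
  \<open>V\<close>, hence continuous.\<close>

lemma continuous_dual_separates:
  fixes x y :: "'a::{locally_convex_space, t2_space}"
  assumes "x \<noteq> y"
  shows "\<exists>f\<in>continuous_dual. f x \<noteq> f y"
proof -
  define a where "a = x - y"
  have "a \<noteq> 0" using assms by (simp add: a_def)
  then obtain U :: "'a set" where "open U" "0 \<in> U" "a \<notin> U"
    using t1_space[of 0 a] by metis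
  then obtain V where V: "open V" "0 \<in> V" "a \<notin> V"
    "\<And>x y u v. x \<in> V \<Longrightarrow> y \<in> V \<Longrightarrow> 0 \<le> u \<Longrightarrow> 0 \<le> v \<Longrightarrow> u + v = 1 \<Longrightarrow> u *\<^sub>R x + v *\<^sub>R y \<in> V"
    using convex_nhds_0[of U] by (metis subset_eq)
  define S where "S = (\<lambda>z. {t. 0 < t \<and> inverse t *\<^sub>R z \<in> V})"
  define g where "g = (\<lambda>z. Inf (S z))"
  have bdd: "bdd_below (S z)" for z
    by (rule bdd_belowI[of _ 0]) (auto simp: S_def)
  have ne: "S z \<noteq> {}" for z
  proof -
    \<comment> \<open>\<open>V\<close> is absorbing because s z tends to 0 as s decreases to 0; so
      the gauge is an infimum over a nonempty set.\<close>
    have "((\<lambda>s. s *\<^sub>R z) \<longlongrightarrow> 0 *\<^sub>R z) (at_right (0::real))"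
      by (intro tendsto_scaleR_locally_convex tendsto_intros)
    then have "eventually (\<lambda>s. s *\<^sub>R z \<in> V) (at_right (0::real))"
      using V by (auto simp: tendsto_def)
    then have "eventually (\<lambda>s. s > 0 \<and> s *\<^sub>R z \<in> V) (at_right (0::real))"
      by (simp add: eventually_conj_iff eventually_at_right_less)
    then obtain s :: real where "s > 0" "s *\<^sub>R z \<in> V"
      using eventually_happens trivial_limit_at_right_real by blast
    then have "inverse s \<in> S z" by (simp add: S_def)
    then show ?thesis by blast
  qed
  have le: "g z \<le> t" if "t \<in> S z" for t z
    unfolding g_def by (rule cInf_lower[OF that bdd])
  have ge: "c \<le> g z" if "\<And>t. t \<in> S z \<Longrightarrow> c \<le> t" for c z
    unfolding g_def by (rule cInf_greatest[OF ne that])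
  have "sublinear g"
    unfolding sublinear_def
  proof (intro conjI allI impI)
    fix z w
    have *: "g (z + w) \<le> t + s" if "t \<in> S z" "s \<in> S w" for t s
    proof (rule le)
      have ts: "t > 0" "s > 0" using that by (auto simp: S_def)
      then have sum: "t / (t + s) + s / (t + s) = 1"
        by (simp add: add_divide_distrib[symmetric])
      have "(t / (t + s)) *\<^sub>R (inverse t *\<^sub>R z) + (s / (t + s)) *\<^sub>R (inverse s *\<^sub>R w) \<in> V"
        by (rule V(4)) (use that sum ts in \<open>auto simp: S_def\<close>)
      moreover have "(t / (t + s)) *\<^sub>R (inverse t *\<^sub>R z) + (s / (t + s)) *\<^sub>R (inverse s *\<^sub>R w)
        = inverse (t + s) *\<^sub>R (z + w)"
      proof -
        have "(t / (t + s)) * inverse t = inverse (t + s)" "(s / (t + s)) * inverse s = inverse (t + s)"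
          using ts by (simp_all add: field_simps)
        then show ?thesis by (simp only: scaleR_scaleR scaleR_add_right)
      qed
      ultimately show "t + s \<in> S (z + w)" using ts by (simp add: S_def)
    qed
    have "g (z + w) - t \<le> g w" if "t \<in> S z" for t
      using *[OF that] by (intro ge) (simp add: algebra_simps)
    then have "g (z + w) - g w \<le> g z" by (intro ge) (simp add: algebra_simps)
    then show "g (z + w) \<le> g z + g w" by simp
  next
    fix r :: real and z assume r: "r > 0"
    have "g (r *\<^sub>R z) / r \<le> g z"
    proof (rule ge)
      fix t assume "t \<in> S z"
      moreover have "inverse (r * t) *\<^sub>R (r *\<^sub>R z) = inverse t *\<^sub>R z"
        using r by (simp add: field_simps)
      ultimately have "r * t \<in> S (r *\<^sub>R z)" using r by (simp add: S_def del: scaleR_scaleR)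
      from le[OF this] show "g (r *\<^sub>R z) / r \<le> t" using r by (simp add: field_simps)
    qed
    then show "g (r *\<^sub>R z) \<le> r * g z" using r by (simp add: field_simps)
  qed
  then obtain f where f: "linear f" "\<And>z. f z \<le> g z" "f a = g a"
    using Hahn_Banach_sublinear by blast
  \<comment> \<open>If a \<in> t V with t < 1, convexity together with 0 \<in> V would put
    \<open>a\<close> into \<open>V\<close>.\<close>
  have "1 \<le> g a"
  proof (rule ge, rule ccontr)
    fix t assume t: "t \<in> S a" "\<not> 1 \<le> t"
    then have "t *\<^sub>R (inverse t *\<^sub>R a) + (1 - t) *\<^sub>R 0 \<in> V"
      by (intro V(4)) (auto simp: S_def V(2))
    then show False using t V(3) by (simp add: S_def)
  qed
  then have "f x \<noteq> f y" using f by (simp add: a_def linear_diff)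
  moreover have "f z \<le> 1" if "z \<in> V" for z
    using f(2)[of z] le[of 1 z] that by (simp add: S_def)
  then have "continuous_on UNIV f"
    by (rule linear_continuous_if_le_on_neighbourhood[OF f(1) V(1,2)])
  ultimately show ?thesis using f(1) by (auto simp: continuous_dual_def)
qed

section \<open>Extreme points and barycenters\<close>

lemma continuous_dualD:
  assumes "f \<in> continuous_dual"
  shows "linear f" "continuous_on A f"
  using assms continuous_on_subset unfolding continuous_dual_def by blast+

lemma continuous_dual_add:
  "f \<in> continuous_dual \<Longrightarrow> g \<in> continuous_dual \<Longrightarrow> (\<lambda>x. f x + g x) \<in> continuous_dual"
  by (auto simp: continuous_dual_def intro: continuous_intros linear_compose_add)

lemma continuous_dual_cmult: "f \<in> continuous_dual \<Longrightarrow> (\<lambda>x. c * f x) \<in> continuous_dual"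
  using linear_compose_scale_right[where 'b=real, of f c]
  by (auto simp: continuous_dual_def intro: continuous_intros)

lemma continuous_dual_zero: "(\<lambda>x. 0) \<in> continuous_dual"
  by (auto simp: continuous_dual_def linear_zero)

lemma compact_Int_Inter_nonempty:
  assumes "compact U" "\<And>S. S \<in> \<A> \<Longrightarrow> closed S"
    and "\<And>\<B>. \<B> \<subseteq> \<A> \<Longrightarrow> finite \<B> \<Longrightarrow> U \<inter> \<Inter> \<B> \<noteq> {}"
  shows "U \<inter> \<Inter> \<A> \<noteq> {}"
proof -
  have "\<forall>\<A>. (\<forall>S\<in>\<A>. closed S) \<longrightarrow> (\<forall>\<B>\<subseteq>\<A>. finite \<B> \<longrightarrow> U \<inter> \<Inter> \<B> \<noteq> {}) \<longrightarrow> U \<inter> \<Inter> \<A> \<noteq> {}"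
    using assms(1) by (simp only: compact_fip)
  from this[THEN spec, of \<A>] show ?thesis using assms(2,3) by blast
qed

lemma compact_level_set:
  fixes f :: "'a::t2_space \<Rightarrow> real"
  assumes "compact K" "continuous_on K f"
  shows "compact {x\<in>K. f x = c}" "compact {x\<in>K. f x \<le> c}" "compact {x\<in>K. c \<le> f x}"
proof -
  have "closed K" using assms by (simp add: compact_imp_closed)
  have "compact (K \<inter> f -` S)" if "closed S" for S
    using compact_Int_closed[OF assms(1) continuous_closed_preimage[OF assms(2) \<open>closed K\<close> that]]
    by (simp add: Int_assoc[symmetric])
  from this[of "{c}"] this[of "{..c}"] this[of "{c..}"]
  show "compact {x\<in>K. f x = c}" "compact {x\<in>K. f x \<le> c}" "compact {x\<in>K. c \<le> f x}"
    by (simp_all add: vimage_def Int_def)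
qed

section \<open>Faces and extreme points (Krein-Milman)\<close>

lemma minimum_set_face_of:
  fixes f :: "'a::real_vector \<Rightarrow> real"
  assumes S: "convex S" and f: "linear f" and m: "\<And>x. x \<in> S \<Longrightarrow> m \<le> f x"
  shows "{x\<in>S. f x = m} face_of S"
  unfolding face_of_def
proof (intro conjI ballI impI)
  have "{x. f x = m} = f -` {m}" by auto
  then have "convex {x. f x = m}"
    using convex_linear_vimage[OF f, of "{m}"] by simp
  then show "convex {x\<in>S. f x = m}"
    using convex_Int[OF S, of "{x. f x = m}"] by (simp add: Int_def)
next
  fix a b x assume ab: "a \<in> S" "b \<in> S" and x: "x \<in> {x\<in>S. f x = m}" "x \<in> open_segment a b"
  then obtain u where u: "0 < u" "u < 1" "x = (1 - u) *\<^sub>R a + u *\<^sub>R b"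
    by (auto simp: in_segment)
  have "f x = (1 - u) * f a + u * f b"
    unfolding u(3) by (simp add: linear_add[OF f] linear_cmul[OF f])
  \<comment> \<open>Two nonnegative terms with positive weights sum to zero, so each endpoint
    attains the minimum.\<close>
  then have eq: "(1 - u) * (f a - m) + u * (f b - m) = 0"
    using x(1) by (simp add: algebra_simps)
  have nn: "0 \<le> (1 - u) * (f a - m)" "0 \<le> u * (f b - m)"
    using u ab m by simp_all
  then have "(1 - u) * (f a - m) = 0" "u * (f b - m) = 0"
    using eq by linarith+
  then show "a \<in> {x\<in>S. f x = m}" "b \<in> {x\<in>S. f x = m}"
    using u ab by auto
qed auto

text \<open>A minimal nonempty compact face is a single point: a continuous form taking different
  values at two of its points would cut out, by its minimum, a strictly smaller compact face. The
  minimal face exists by Zorn, as chains of compact faces have nonempty intersection.\<close>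

lemma compact_convex_has_extreme_point:
  fixes C :: "'a::{locally_convex_space, t2_space} set"
  assumes C: "compact C" "convex C" "C \<noteq> {}"
  shows "\<exists>x. x extreme_point_of C"
proof -
  define A where "A = {F. F face_of C \<and> compact F \<and> F \<noteq> {}}"
  have CA: "C \<in> A" using C by (auto simp: A_def face_of_refl)
  have "\<exists>M\<in>A. \<forall>F\<in>A. F \<subseteq> M \<longrightarrow> F = M"
  proof (rule predicate_Zorn)
    show "partial_order_on A (relation_of (\<lambda>F F'. F' \<subseteq> F) A)"
      by (rule partial_order_on_relation_ofI) auto
    fix Q assume Q: "Q \<in> Chains (relation_of (\<lambda>F F'. F' \<subseteq> F) A)"
    then have QA: "Q \<subseteq> A" by (auto simp: Chains_def relation_of_def)
    show "\<exists>u\<in>A. \<forall>F\<in>Q. u \<subseteq> F"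
    proof (cases "Q = {}")
      case True
      then show ?thesis using CA by auto
    next
      case False
      have cl: "closed F" if "F \<in> Q" for F
        using that QA by (auto simp: A_def intro: compact_imp_closed)
      \<comment> \<open>A finite subfamily of a chain has a least member, which is its intersection;
        this gives the finite intersection property.\<close>
      have least: "\<exists>F\<in>B. \<forall>F'\<in>B. F \<subseteq> F'" if "finite B" "B \<noteq> {}" "B \<subseteq> Q" for B
        using that
      proof (induction rule: finite_ne_induct)
        case (insert F B)
        then obtain G where G: "G \<in> B" "\<forall>F'\<in>B. G \<subseteq> F'" by auto
        have "F \<subseteq> G \<or> G \<subseteq> F"
          using Q G(1) insert.prems by (auto simp: Chains_def relation_of_def)
        then show ?case
        proof
          assume "F \<subseteq> G"
          then show ?thesis using G by (intro bexI[of _ F]) auto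
        next
          assume "G \<subseteq> F"
          then show ?thesis using G by (intro bexI[of _ G]) auto
        qed
      qed simp
      have "C \<inter> \<Inter> Q \<noteq> {}"
      proof (rule compact_Int_Inter_nonempty[OF C(1)])
        fix B assume B: "B \<subseteq> Q" "finite B"
        show "C \<inter> \<Inter> B \<noteq> {}"
        proof (cases "B = {}")
          case False
          then obtain F where F: "F \<in> B" "\<forall>F'\<in>B. F \<subseteq> F'"
            using least[OF B(2) False B(1)] by blast
          then have "F \<subseteq> C \<inter> \<Inter> B" "F \<noteq> {}"
            using QA B by (auto simp: A_def dest: face_of_imp_subset)
          then show ?thesis by blast
        qed (use C in auto)
      qed (use cl in auto)
      moreover have "\<Inter> Q face_of C"
        using QA False by (intro face_of_Inter) (auto simp: A_def)
      moreover have "C \<inter> \<Inter> Q = \<Inter> Q"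
        using \<open>\<Inter> Q face_of C\<close> face_of_imp_subset by blast
      moreover have "compact (C \<inter> \<Inter> Q)"
        using cl C(1) by (intro compact_Int_closed closed_Inter) auto
      ultimately have "\<Inter> Q \<in> A" by (simp add: A_def)
      then show ?thesis by blast
    qed
  qed
  then obtain M where M: "M face_of C" "compact M" "M \<noteq> {}"
    and minimal: "\<And>F. F face_of C \<Longrightarrow> compact F \<Longrightarrow> F \<noteq> {} \<Longrightarrow> F \<subseteq> M \<Longrightarrow> F = M"
    by (auto simp: A_def)
  obtain a where a: "a \<in> M" using M by blast
  have "b = a" if b: "b \<in> M" for b
  proof (rule ccontr)
    assume "b \<noteq> a"
    then obtain f where f: "f \<in> continuous_dual" "f b \<noteq> f a"
      using continuous_dual_separates by blast
    obtain x0 where x0: "x0 \<in> M" "\<And>y. y \<in> M \<Longrightarrow> f x0 \<le> f y"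
      using continuous_attains_inf[OF M(2,3) continuous_dualD(2)[OF f(1)]] by blast
    let ?F = "{x\<in>M. f x = f x0}"
    have "?F face_of M"
      using M(1) f(1) x0(2) by (intro minimum_set_face_of) (auto simp: face_of_imp_convex dest: continuous_dualD)
    then have "?F = M"
      using M x0 f(1) by (intro minimal) (auto intro: face_of_trans compact_level_set continuous_dualD)
    then show False using a b f(2) by (metis (mono_tags, lifting) mem_Collect_eq)
  qed
  then have "M = {a}" using a by blast
  then show ?thesis using M(1) face_of_singleton[of a C] by auto
qed

lemma Ext_subset: "Ext C \<subseteq> C"
  by (auto simp: Ext_def extreme_point_of_def)

text \<open>Bauer's principle for linear forms: the set of minimizers is a compact face, and an
  extreme point of a face is extreme in \<open>C\<close>.\<close>

lemma continuous_dual_minimum_on_Ext: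
  fixes C :: "'a::{locally_convex_space, t2_space} set"
  assumes C: "compact C" "convex C" and f: "f \<in> continuous_dual" and x: "x \<in> C"
  shows "\<exists>e\<in>Ext C. f e \<le> f x"
proof -
  obtain x0 where x0: "x0 \<in> C" "\<And>y. y \<in> C \<Longrightarrow> f x0 \<le> f y"
    using continuous_attains_inf[OF C(1) _ continuous_dualD(2)[OF f]] x by blast
  let ?F = "{x\<in>C. f x = f x0}"
  have F: "?F face_of C"
    using C f x0(2) by (intro minimum_set_face_of) (auto dest: continuous_dualD)
  obtain e where e: "e extreme_point_of ?F"
    using compact_convex_has_extreme_point[of ?F] C f x0(1) F
    by (auto intro: compact_level_set continuous_dualD face_of_imp_convex)
  then have "e \<in> Ext C" "f e = f x0"
    using extreme_point_of_face[OF F] by (auto simp: Ext_def)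
  then show ?thesis using x0(2)[OF x] by metis
qed

lemma compact_Ext_stable:
  fixes C :: "'a::{locally_convex_space, t2_space} set"
  assumes "compact C" "stable_convex C"
  shows "compact (Ext C)"
proof -
  have conv: "convex C" and
    op: "open_map (top_of_set (C \<times> C)) (top_of_set C) (\<lambda>(x, y). midpoint x y)"
    using assms by (auto simp: stable_convex_def)
  have clC: "closed C" using assms by (simp add: compact_imp_closed)
  have nbhd: "\<exists>T. open T \<and> x \<in> T \<and> T \<subseteq> - Ext C" if x: "x \<notin> Ext C" for x
  proof (cases "x \<in> C")
    case False
    then show ?thesis using clC Ext_subset[of C] by (intro exI[of _ "- C"]) auto
  next
    case True
    then obtain a b where ab: "a \<in> C" "b \<in> C" "a \<noteq> b" "x = midpoint a b"
    proof -
      obtain a b u where ab: "a \<in> C" "b \<in> C" "a \<noteq> b" "0 < u" "u < 1" "x = (1 - u) *\<^sub>R a + u *\<^sub>R b"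
        using x True by (auto simp: Ext_def extreme_point_of_def in_segment)
      \<comment> \<open>Failure of extremality gives weights (1 - u, u) that need not be equal.
        Moving by the same \<open>r\<close> to both sides along the segment turns \<open>x\<close>
        into a proper midpoint.\<close>
      define r where "r = min u (1 - u)"
      have r: "0 < r" "r \<le> u" "r \<le> 1 - u" using ab by (auto simp: r_def)
      define v where "v = (\<lambda>s. (1 - s) *\<^sub>R a + s *\<^sub>R b)"
      have "v (u - r) \<in> C" "v (u + r) \<in> C"
        unfolding v_def using conv ab r by (auto intro!: convexD_alt)
      moreover have "v (u + r) - v (u - r) = (2 * r) *\<^sub>R (b - a)"
        by (simp add: v_def algebra_simps flip: scaleR_2)
      then have "v (u - r) \<noteq> v (u + r)" using r ab by auto
      moreover have "v (u - r) + v (u + r) = 2 *\<^sub>R x"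
        by (simp add: v_def ab(6) algebra_simps flip: scaleR_2)
      then have "x = midpoint (v (u - r)) (v (u + r))"
        by (simp add: midpoint_def)
      ultimately show ?thesis by (intro that)
    qed
    \<comment> \<open>Disjoint neighbourhoods guarantee that every midpoint of a point of
      \<open>U\<close> and a point of \<open>V\<close> is proper. By stability these midpoints fill
      a relative neighbourhood of \<open>x\<close>, which therefore contains no extreme
      point.\<close>
    obtain U V where UV: "open U" "open V" "a \<in> U" "b \<in> V" "U \<inter> V = {}"
      using hausdorff[OF ab(3)] by blast
    have "openin (top_of_set (C \<times> C)) ((C \<times> C) \<inter> (U \<times> V))"
      using UV by (intro openin_open_Int open_Times)
    then have "openin (top_of_set C) ((\<lambda>(x, y). midpoint x y) ` ((C \<times> C) \<inter> (U \<times> V)))"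
      using op unfolding open_map_def by blast
    then obtain T where T: "open T" "(\<lambda>(x, y). midpoint x y) ` ((C \<times> C) \<inter> (U \<times> V)) = C \<inter> T"
      by (auto simp: openin_open)
    have "x \<in> (\<lambda>(x, y). midpoint x y) ` ((C \<times> C) \<inter> (U \<times> V))"
      using ab UV by (intro image_eqI[of _ _ "(a, b)"]) auto
    then have "x \<in> T" using T by blast
    moreover have "e \<notin> Ext C" if "e \<in> T" for e
    proof
      assume e: "e \<in> Ext C"
      then have "e \<in> C \<inter> T" using that Ext_subset by blast
      then obtain u v where uv: "e = midpoint u v" "u \<in> C" "v \<in> C" "u \<in> U" "v \<in> V"
        using T(2)[symmetric] by auto
      then have "u \<noteq> v" using UV by blast
      moreover have "midpoint u v = (1 - 1/2) *\<^sub>R u + (1/2) *\<^sub>R v"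
        by (simp add: midpoint_def scaleR_add_right)
      ultimately have "e \<in> open_segment u v"
        unfolding in_segment uv(1) by (intro conjI exI[of _ "1/2"]) auto
      then show False using e uv(2,3) by (auto simp: Ext_def extreme_point_of_def)
    qed
    ultimately show ?thesis using T(1) by blast
  qed
  have "open (- Ext C)"
    unfolding open_subopen[of "- Ext C"] using nbhd by simp
  then have "closed (Ext C)" by (simp add: closed_def)
  then show ?thesis
    using compact_Int_closed[OF assms(1), of "Ext C"] Ext_subset[of C] by (simp add: Int_absorb1)
qed

section \<open>Barycenters\<close>

lemma borel_prob_integrable:
  fixes g :: "'a::t2_space \<Rightarrow> real"
  assumes "prob_space M" "sets M = sets (restrict_space borel E)" "compact E" "continuous_on E g"
  shows "integrable M g"
proof -
  interpret prob_space M by fact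
  have sp: "space M = E"
    using sets_eq_imp_space_eq[OF assms(2)] by (simp add: space_restrict_space)
  have "bounded (g ` E)"
    using compact_continuous_image[OF assms(4,3)] by (rule compact_imp_bounded)
  then obtain B where "\<And>x. x \<in> E \<Longrightarrow> norm (g x) \<le> B"
    unfolding bounded_iff by auto
  moreover have "g \<in> borel_measurable M"
    using borel_measurable_continuous_on_restrict[OF assms(4)] assms(2)
    by (simp cong: measurable_cong_sets)
  ultimately show ?thesis
    using sp by (intro integrable_const_bound[where B=B]) auto
qed

text \<open>Compactness reduces the claim to finitely many forms. For these the squared residual
  \<open>\<phi>\<close> is minimized over \<open>C\<close>; the first-order condition at the
  minimizer, integrated against \<open>M\<close>, forces the residual to vanish. This takes the
  place of a separation argument in finite dimension.\<close>

lemma barycenter_exists: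
  fixes C :: "'a::{locally_convex_space, t2_space} set"
  assumes C: "compact C" "convex C" and E: "E \<subseteq> C" "compact E"
    and M: "prob_space M" "sets M = sets (restrict_space borel E)"
  shows "\<exists>x\<in>C. \<forall>f\<in>continuous_dual. (\<integral>z. f z \<partial>M) = f x"
proof -
  interpret prob_space M by fact
  have sp: "space M = E"
    using sets_eq_imp_space_eq[OF M(2)] by (simp add: space_restrict_space)
  have int: "integrable M f" if "f \<in> continuous_dual" for f :: "'a \<Rightarrow> real"
    by (rule borel_prob_integrable[OF M E(2)]) (rule continuous_dualD[OF that])
  define J where "J = (\<lambda>f::'a \<Rightarrow> real. \<integral>z. f z \<partial>M)"
  define \<A> where "\<A> = (\<lambda>f. {x\<in>C. f x = J f}) ` (continuous_dual :: ('a \<Rightarrow> real) set)"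
  have "C \<inter> \<Inter> \<A> \<noteq> {}"
  proof (rule compact_Int_Inter_nonempty[OF C(1)])
    fix S assume "S \<in> \<A>"
    then obtain f where "f \<in> continuous_dual" "S = {x\<in>C. f x = J f}"
      by (auto simp: \<A>_def)
    then show "closed S"
      using compact_imp_closed[OF compact_level_set(1)[OF C(1) continuous_dualD(2)]] by blast
  next
    fix \<B> assume "\<B> \<subseteq> \<A>" "finite \<B>"
    then obtain T where T: "T \<subseteq> continuous_dual" "finite T" "\<B> = (\<lambda>f. {x\<in>C. f x = J f}) ` T"
      unfolding \<A>_def using finite_subset_image by (smt (verit, best))
    define \<phi> where "\<phi> = (\<lambda>x. \<Sum>f\<in>T. (f x - J f)\<^sup>2)"
    have "C \<noteq> {}" using not_empty sp E by auto
    moreover have "continuous_on C \<phi>"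
      unfolding \<phi>_def using T by (intro continuous_intros continuous_dualD(2)) auto
    ultimately obtain x0 where x0: "x0 \<in> C" "\<And>y. y \<in> C \<Longrightarrow> \<phi> x0 \<le> \<phi> y"
      using continuous_attains_inf[OF C(1)] by blast
    define a where "a = (\<lambda>f::'a \<Rightarrow> real. f x0 - J f)"
    have var: "0 \<le> (\<Sum>f\<in>T. a f * (f y - f x0))" if y: "y \<in> C" for y
    proof (rule ccontr)
      define P where "P = (\<Sum>f\<in>T. a f * (f y - f x0))"
      define R where "R = (\<Sum>f\<in>T. (f y - f x0)\<^sup>2)"
      assume "\<not> ?thesis"
      then have P: "P < 0" by (simp add: P_def)
      have R: "0 \<le> R" by (simp add: R_def sum_nonneg)
      \<comment> \<open>Along the segment towards \<open>y\<close> the residual changes by t (2 P +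
        t R). With t R \<le> -P this is at most t P, which is negative and contradicts
        minimality.\<close>
      define t where "t = min 1 (- P / (R + 1))"
      have t: "0 < t" "t \<le> 1" "t * (R + 1) \<le> - P"
      proof -
        have "0 < - P / (R + 1)" using P R by (intro divide_pos_pos) auto
        then show "0 < t" "t \<le> 1" by (auto simp: t_def)
        have "t \<le> - P / (R + 1)" by (simp add: t_def)
        from pos_le_divide_eq[THEN iffD1, OF _ this] show "t * (R + 1) \<le> - P" using R by simp
      qed
      have "\<phi> ((1 - t) *\<^sub>R x0 + t *\<^sub>R y) = (\<Sum>f\<in>T. (a f + t * (f y - f x0))\<^sup>2)"
        unfolding \<phi>_def
      proof (intro sum.cong refl)
        fix f assume "f \<in> T"
        then have "linear f" using T continuous_dualD by blast
        then show "(f ((1 - t) *\<^sub>R x0 + t *\<^sub>R y) - J f)\<^sup>2 = (a f + t * (f y - f x0))\<^sup>2"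
          by (simp add: a_def linear_add linear_diff linear_cmul algebra_simps)
      qed
      also have "\<dots> = \<phi> x0 + t * (2 * P + t * R)"
        by (simp add: \<phi>_def a_def P_def R_def power2_eq_square sum.distrib sum_distrib_left algebra_simps sum_subtractf)
      finally have "0 \<le> t * (2 * P + t * R)"
        using x0(2)[OF convexD_alt[OF C(2) x0(1) y, of t]] t(1,2) by linarith
      then have "0 \<le> 2 * P + t * R" using t by (simp add: zero_le_mult_iff)
      moreover have "t * R \<le> - P" using t by (simp add: algebra_simps)
      ultimately show False using P by linarith
    qed
    \<comment> \<open>The variational inequality holds at every point of \<open>E\<close>.
      Integration replaces \<open>f z\<close> by \<open>J f\<close>, and J f - f x0 = -a f turns the
      sum into minus a sum of squares.\<close>
    have "0 \<le> (\<integral>z. (\<Sum>f\<in>T. a f * (f z - f x0)) \<partial>M)"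
      using var sp E by (intro Bochner_Integration.integral_nonneg_AE) auto
    also have "\<dots> = (\<Sum>f\<in>T. a f * (J f - f x0))"
    proof -
      have "(\<integral>z. (\<Sum>f\<in>T. a f * (f z - f x0)) \<partial>M) = (\<Sum>f\<in>T. \<integral>z. a f * (f z - f x0) \<partial>M)"
        using T int by (intro Bochner_Integration.integral_sum) auto
      also have "\<dots> = (\<Sum>f\<in>T. a f * (J f - f x0))"
        using T int by (intro sum.cong refl) (auto simp: J_def prob_space subset_eq)
      finally show ?thesis .
    qed
    also have "\<dots> = - (\<Sum>f\<in>T. (a f)\<^sup>2)"
      by (simp add: a_def power2_eq_square sum_negf[symmetric] algebra_simps)
    finally have "(\<Sum>f\<in>T. (a f)\<^sup>2) = 0"
      using sum_nonneg[of T "\<lambda>f. (a f)\<^sup>2"] by simp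
    then have "\<forall>f\<in>T. a f = 0"
      using T(2) by (simp add: sum_nonneg_eq_0_iff)
    then show "C \<inter> \<Inter> \<B> \<noteq> {}"
      using x0(1) T(3) by (auto simp: a_def)
  qed
  then show ?thesis by (auto simp: \<A>_def J_def)
qed

section \<open>Radon measures on compact metrizable sets\<close>

text \<open>On a compact set, a continuous nonnegative function vanishing exactly on the diagonal
  does the work of a metric. In this form the structure passes to \<open>E \<times> E\<close> by
  adding the functions of the two coordinates.\<close>

locale compact_separated =
  fixes E :: "'a::t2_space set" and \<delta> :: "'a \<Rightarrow> 'a \<Rightarrow> real"
  assumes compact: "compact E"
    and continuous: "continuous_on (E \<times> E) (\<lambda>w. \<delta> (fst w) (snd w))"
    and nonneg: "x \<in> E \<Longrightarrow> y \<in> E \<Longrightarrow> 0 \<le> \<delta> x y"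
    and zero_iff: "x \<in> E \<Longrightarrow> y \<in> E \<Longrightarrow> \<delta> x y = 0 \<longleftrightarrow> x = y"
begin

lemma continuous_on_left: "x \<in> E \<Longrightarrow> continuous_on E (\<lambda>y. \<delta> x y)"
  using continuous_on_compose2[OF continuous, of E "\<lambda>y. (x, y)"]
  by (force intro: continuous_intros)

lemma continuous_on_right: "y \<in> E \<Longrightarrow> continuous_on E (\<lambda>x. \<delta> x y)"
  using continuous_on_compose2[OF continuous, of E "\<lambda>x. (x, y)"]
  by (force intro: continuous_intros)

lemma compact_diff_openin:
  assumes "openin (top_of_set E) W"
  shows "compact (E - W)"
proof -
  obtain T where "open T" "W = E \<inter> T" using assms by (auto simp: openin_open)
  then show ?thesis using compact_diff[OF compact, of T] by (simp add: Diff_Int)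
qed

text \<open>\<open>\<delta> x\<close> attains a positive minimum on the compact set
  \<open>E - W\<close>; thus the sublevel sets of \<open>\<delta> x\<close> form a neighbourhood
  base at \<open>x\<close>.\<close>

lemma separated_from_closed:
  assumes W: "openin (top_of_set E) W" "x \<in> W"
  shows "\<exists>r>0. \<forall>z\<in>E - W. r \<le> \<delta> x z"
proof (cases "E - W = {}")
  case True
  then show ?thesis by (intro exI[of _ 1]) auto
next
  case False
  have x: "x \<in> E" using W openin_imp_subset by blast
  obtain z where z: "z \<in> E - W" "\<And>y. y \<in> E - W \<Longrightarrow> \<delta> x z \<le> \<delta> x y"
    using continuous_attains_inf[OF compact_diff_openin[OF W(1)] False
        continuous_on_subset[OF continuous_on_left[OF x] Diff_subset]] by blast
  have "\<delta> x z \<noteq> 0" using zero_iff[OF x] z(1) W(2) by blast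
  then have "0 < \<delta> x z" using nonneg[OF x] z(1) by (simp add: less_le)
  then show ?thesis using z(2) by blast
qed

text \<open>\<open>K n\<close> collects the points at \<open>\<delta>\<close>-distance at least
  1/(n+1) from the complement. All later regularity and measurability statements rest on this
  exhaustion.\<close>

lemma openin_sigma_compact:
  assumes W: "openin (top_of_set E) W"
  obtains K :: "nat \<Rightarrow> 'a set" where "\<And>n. compact (K n)" "incseq K" "W = (\<Union>n. K n)"
proof
  define K where "K = (\<lambda>n. {x\<in>E. \<forall>z\<in>E - W. inverse (real (Suc n)) \<le> \<delta> x z})"
  show "compact (K n)" for n
  proof -
    have "compact {x\<in>E. inverse (real (Suc n)) \<le> \<delta> x z}" if "z \<in> E - W" for z
      using that by (intro compact_level_set compact continuous_on_right) auto
    then have "closed (\<Inter>z\<in>E - W. {x\<in>E. inverse (real (Suc n)) \<le> \<delta> x z})"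
      by (intro closed_INT) (auto intro: compact_imp_closed)
    \<comment> \<open>If \<open>E - W\<close> is empty the intersection over \<open>z\<close> is the
      whole space, so it is cut down to \<open>E\<close>.\<close>
    then have "compact (E \<inter> (\<Inter>z\<in>E - W. {x\<in>E. inverse (real (Suc n)) \<le> \<delta> x z}))"
      by (rule compact_Int_closed[OF compact])
    moreover have "E \<inter> (\<Inter>z\<in>E - W. {x\<in>E. inverse (real (Suc n)) \<le> \<delta> x z}) = K n"
      unfolding K_def by blast
    ultimately show ?thesis by simp
  qed
  show "incseq K"
  proof (rule monoI)
    fix m n :: nat assume "m \<le> n"
    then have "inverse (real (Suc n)) \<le> inverse (real (Suc m))" by simp
    then show "K m \<subseteq> K n" unfolding K_def using order_trans by blast
  qed
  show "W = (\<Union>n. K n)"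
  proof
    show "W \<subseteq> (\<Union>n. K n)"
    proof
      fix x assume x: "x \<in> W"
      then obtain r where r: "r > 0" "\<forall>z\<in>E - W. r \<le> \<delta> x z"
        using separated_from_closed[OF W] by blast
      obtain n where "inverse (real (Suc n)) < r" using reals_Archimedean[OF r(1)] by blast
      moreover have "x \<in> E" using x W openin_imp_subset by blast
      ultimately have "x \<in> K n" using r(2) unfolding K_def by force
      then show "x \<in> (\<Union>n. K n)" by blast
    qed
    show "(\<Union>n. K n) \<subseteq> W"
    proof
      fix x assume "x \<in> (\<Union>n. K n)"
      then obtain n where x: "x \<in> E" "\<forall>z\<in>E - W. inverse (real (Suc n)) \<le> \<delta> x z"
        by (auto simp: K_def)
      show "x \<in> W"
      proof (rule ccontr)
        assume "x \<notin> W"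
        then have "inverse (real (Suc n)) \<le> \<delta> x x" using x by blast
        moreover have "\<delta> x x = 0" using zero_iff[OF x(1) x(1)] by simp
        ultimately show False by simp
      qed
    qed
  qed
qed

section \<open>Regularity of Borel probability measures\<close>

lemma sets_restrict_borel:
  "sets (restrict_space borel E) = sigma_sets E {W. openin (top_of_set E) W}"
proof -
  have "E \<in> sets borel" using compact by (simp add: compact_imp_closed)
  then have "E \<in> sigma_sets UNIV {S. open S}" by (simp add: borel_def)
  then have "(\<inter>) E ` sigma_sets UNIV {S. open S} = sigma_sets E ((\<inter>) E ` {S. open S})"
    by (rule sigma_sets_Int) simp
  moreover have "(\<inter>) E ` {S. open S} = {W. openin (top_of_set E) W}"
    by (auto simp: openin_open)
  ultimately show ?thesis by (simp add: sets_restrict_space borel_def)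
qed

lemma space_restrict_borel: "space (restrict_space borel E) = E"
  by (simp add: space_restrict_space)

lemma openin_in_sets: "openin (top_of_set E) W \<Longrightarrow> W \<in> sets (restrict_space borel E)"
  unfolding sets_restrict_borel by (intro sigma_sets.Basic) simp

lemma compact_in_sets:
  assumes "compact K" "K \<subseteq> E"
  shows "K \<in> sets (restrict_space borel E)"
proof -
  have "K \<in> sets borel" using assms by (simp add: compact_imp_closed)
  then have "E \<inter> K \<in> sets (restrict_space borel E)" by (auto simp: sets_restrict_space)
  then show ?thesis using assms(2) by (simp add: Int_absorb1)
qed

text \<open>Approximating from inside and outside at once makes the property symmetric: complements
  exchange \<open>K\<close> and \<open>U\<close> and leave \<open>U - K\<close> unchanged. For open
  sets it follows from the compact exhaustion and continuity from above.\<close>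

lemma borel_regular:
  assumes M: "prob_space M" "sets M = sets (restrict_space borel E)"
    and A: "A \<in> sets M" and e: "0 < e"
  shows "\<exists>K U. compact K \<and> K \<subseteq> A \<and> A \<subseteq> U \<and> openin (top_of_set E) U \<and> measure M (U - K) < e"
proof -
  interpret prob_space M by fact
  have op: "W \<in> sets M" if "openin (top_of_set E) W" for W
    using openin_in_sets[OF that] M(2) by simp
  have cp: "K \<in> sets M" if "compact K" "K \<subseteq> E" for K
    using compact_in_sets[OF that] M(2) by simp
  have sub: "W \<subseteq> E" if "openin (top_of_set E) W" for W
    using that openin_imp_subset by blast
  have "A \<in> sigma_sets E {W. openin (top_of_set E) W}"
    using A M(2) sets_restrict_borel by simp
  then show ?thesis using e
  proof (induction A arbitrary: e)
    case (Basic W)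
    then have W: "openin (top_of_set E) W" by simp
    obtain K where K: "\<And>n. compact (K n)" "incseq K" "W = (\<Union>n. K n)"
      using openin_sigma_compact[OF W] by blast
    have KW: "K n \<subseteq> W" for n using K by blast
    have "(\<lambda>n. measure M (W - K n)) \<longlonglongrightarrow> measure M (\<Inter>n. W - K n)"
    proof (rule finite_Lim_measure_decseq)
      show "range (\<lambda>n. W - K n) \<subseteq> events"
        using op[OF W] cp[OF K(1)] KW sub[OF W] by blast
      show "decseq (\<lambda>n. W - K n)" using K(2) by (auto simp: decseq_def incseq_def)
    qed
    moreover have "(\<Inter>n. W - K n) = {}" using K(3) by blast
    ultimately have "(\<lambda>n. measure M (W - K n)) \<longlonglongrightarrow> 0" by (simp only: measure_empty)
    then have "eventually (\<lambda>n. measure M (W - K n) < e) sequentially"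
      using Basic.prems by (rule order_tendstoD)
    then obtain n where "measure M (W - K n) < e" by (meson eventually_sequentially order_refl)
    then show ?case using K(1) KW W by blast
  next
    case Empty
    then show ?case by (intro exI[of _ "{}"]) auto
  next
    case (Compl A)
    obtain K U where KU: "compact K" "K \<subseteq> A" "A \<subseteq> U" "openin (top_of_set E) U" "measure M (U - K) < e"
      using Compl.IH[OF Compl.prems] by blast
    have "compact (E - U)" by (rule compact_diff_openin[OF KU(4)])
    moreover have "openin (top_of_set E) (E - K)"
      using openin_open_Int[of "- K" E] KU(1) by (simp add: Diff_eq compact_imp_closed open_Compl)
    moreover have "(E - K) - (E - U) = U - K" using sub[OF KU(4)] by blast
    ultimately show ?case using KU by (intro exI[of _ "E - U"] exI[of _ "E - K"]) auto
  next
    case (Union A)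
    \<comment> \<open>The errors add up to e/2. The other half of \<open>e\<close> is spent on
      truncating the union of the \<open>K i\<close> to finitely many terms, since the full union
      need not be compact.\<close>
    have "\<exists>K U. compact K \<and> K \<subseteq> A i \<and> A i \<subseteq> U \<and> openin (top_of_set E) U
      \<and> measure M (U - K) < e / 2 * (1/2) ^ Suc i" for i
      by (rule Union.IH) (use Union.prems in simp)
    then obtain K U where KU: "\<And>i. compact (K i)" "\<And>i. K i \<subseteq> A i" "\<And>i. A i \<subseteq> U i"
      "\<And>i. openin (top_of_set E) (U i)" "\<And>i. measure M (U i - K i) < e / 2 * (1/2) ^ Suc i"
      by metis
    have KE: "K i \<subseteq> E" for i using KU sub by blast
    define K' where "K' = (\<lambda>n. \<Union>i<n. K i)"
    have K'M: "K' n \<in> events" for n using cp[OF KU(1) KE] by (auto simp: K'_def)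
    have UKM: "U i - K i \<in> events" for i using op[OF KU(4)] cp[OF KU(1) KE] by blast
    have KM: "(\<Union>i. K i) \<in> events" using cp[OF KU(1) KE] by blast
    have UM: "(\<Union>i. U i) \<in> events" using op[OF KU(4)] by blast
    have "(\<lambda>n. measure M ((\<Union>i. K i) - K' n)) \<longlonglongrightarrow> measure M (\<Inter>n. (\<Union>i. K i) - K' n)"
    proof (rule finite_Lim_measure_decseq)
      show "range (\<lambda>n. (\<Union>i. K i) - K' n) \<subseteq> events" using K'M KM by blast
      show "decseq (\<lambda>n. (\<Union>i. K i) - K' n)" by (force simp: decseq_def K'_def)
    qed
    moreover have "(\<Inter>n. (\<Union>i. K i) - K' n) = {}" by (auto simp: K'_def)
    ultimately have "(\<lambda>n. measure M ((\<Union>i. K i) - K' n)) \<longlonglongrightarrow> 0" by (simp only: measure_empty)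
    then have "eventually (\<lambda>n. measure M ((\<Union>i. K i) - K' n) < e / 2) sequentially"
      using Union.prems by (intro order_tendstoD) auto
    then obtain n where n: "measure M ((\<Union>i. K i) - K' n) < e / 2"
      by (meson eventually_sequentially order_refl)
    have sums: "(\<lambda>i. e / 2 * (1/2) ^ Suc i) sums (e / 2 * 1)"
      by (intro sums_mult power_half_series)
    have summ: "summable (\<lambda>i. measure M (U i - K i))"
      using KU(5) by (intro summable_comparison_test[OF _ sums_summable[OF sums]])
        (auto intro: less_imp_le simp: measure_nonneg)
    have "measure M (\<Union>i. U i - K i) \<le> (\<Sum>i. measure M (U i - K i))"
      using UKM summ by (intro finite_measure_subadditive_countably) auto
    also have "\<dots> \<le> e / 2"
      using suminf_le[OF less_imp_le[OF KU(5)] summ sums_summable[OF sums]] sums_unique[OF sums]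
      by simp
    finally have first: "measure M (\<Union>i. U i - K i) \<le> e / 2" .
    have "measure M ((\<Union>i. U i) - K' n) \<le> measure M ((\<Union>i. U i - K i) \<union> ((\<Union>i. K i) - K' n))"
      using UKM KM K'M by (intro finite_measure_mono) (auto intro!: sets.Un sets.Diff sets.countable_UN)
    also have "\<dots> \<le> measure M (\<Union>i. U i - K i) + measure M ((\<Union>i. K i) - K' n)"
      using UKM KM K'M by (intro measure_Un_le) (auto intro!: sets.Diff sets.countable_UN)
    also have "\<dots> < e" using first n by linarith
    finally have "measure M ((\<Union>i. U i) - K' n) < e" .
    moreover have "compact (K' n)" using KU(1) by (auto simp: K'_def)
    moreover have "K' n \<subseteq> (\<Union>i. A i)" "(\<Union>i. A i) \<subseteq> (\<Union>i. U i)"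
      using KU(2,3) unfolding K'_def by blast+
    moreover have "openin (top_of_set E) (\<Union>i. U i)" using KU(4) by blast
    ultimately show ?case by blast
  qed
qed

text \<open>Reduces the Radon property to having the right sigma-algebra and total mass 1, which is
  all that has to be checked for the measures constructed below.\<close>

lemma radon_probI:
  assumes M: "prob_space M" "sets M = sets (restrict_space borel E)"
  shows "M \<in> radon_prob E"
proof -
  interpret prob_space M by fact
  have sp: "space M = E"
    using sets_eq_imp_space_eq[OF M(2)] space_restrict_borel by simp
  have "emeasure M A = (SUP K\<in>{K. K \<subseteq> A \<and> compact K}. emeasure M K)" if A: "A \<in> sets M" for A
  proof (rule antisym)
    show "(SUP K\<in>{K. K \<subseteq> A \<and> compact K}. emeasure M K) \<le> emeasure M A"
      using A by (intro SUP_least emeasure_mono) auto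
    show "emeasure M A \<le> (SUP K\<in>{K. K \<subseteq> A \<and> compact K}. emeasure M K)"
    proof (rule ennreal_le_epsilon)
      fix e :: real assume e: "0 < e"
      obtain K U where KU: "compact K" "K \<subseteq> A" "A \<subseteq> U" "openin (top_of_set E) U" "measure M (U - K) < e"
        using borel_regular[OF M A e] by blast
      have AE: "A \<subseteq> E" using A sp sets.sets_into_space by blast
      have KM: "K \<in> sets M" using compact_in_sets[OF KU(1)] KU(2) AE M(2) by simp
      have UM: "U \<in> sets M" using openin_in_sets[OF KU(4)] M(2) by simp
      have "emeasure M A \<le> emeasure M (K \<union> (U - K))"
        using KU KM UM by (intro emeasure_mono) auto
      also have "\<dots> \<le> emeasure M K + emeasure M (U - K)"
        using KM UM by (intro emeasure_subadditive) auto
      also have "\<dots> \<le> (SUP K\<in>{K. K \<subseteq> A \<and> compact K}. emeasure M K) + ennreal e"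
        using KU by (intro add_mono SUP_upper) (auto simp: emeasure_eq_measure ennreal_leI)
      finally show "emeasure M A \<le> (SUP K\<in>{K. K \<subseteq> A \<and> compact K}. emeasure M K) + ennreal e" .
    qed
  qed
  then show ?thesis using M by (simp add: radon_prob_def)
qed

lemma radon_prob_iff:
  "M \<in> radon_prob E \<longleftrightarrow> prob_space M \<and> sets M = sets (restrict_space borel E)"
  using radon_probI by (auto simp: radon_prob_def)

end

section \<open>Riesz representation\<close>

text \<open>\<open>L\<close> takes functions on the whole type, while boundedness and order are
  tested on \<open>E\<close> only; monotonicity then makes \<open>L g\<close> depend only on the
  values of a bounded \<open>g\<close> on \<open>E\<close>.\<close>

locale mean_on_bounded = compact_separated E \<delta> for E :: "'a::t2_space set" and \<delta> +
  fixes L :: "('a \<Rightarrow> real) \<Rightarrow> real"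
  assumes add: "bounded (g ` E) \<Longrightarrow> bounded (h ` E) \<Longrightarrow> L (\<lambda>x. g x + h x) = L g + L h"
    and cmult: "bounded (g ` E) \<Longrightarrow> L (\<lambda>x. c * g x) = c * L g"
    and mono: "bounded (g ` E) \<Longrightarrow> bounded (h ` E) \<Longrightarrow> (\<And>x. x \<in> E \<Longrightarrow> g x \<le> h x) \<Longrightarrow> L g \<le> L h"
    and one: "L (\<lambda>x. 1) = 1"
begin

lemma bounded_const: "bounded ((\<lambda>x. c :: real) ` S)"
  by (rule bounded_subset[of "{c}"]) auto

lemma const: "L (\<lambda>x. c) = c"
  using cmult[OF bounded_const, of c 1] one by simp

lemma bounded_indicator: "bounded ((indicator A :: 'a \<Rightarrow> real) ` S)"
  by (rule bounded_subset[of "{0, 1}"]) (auto simp: indicator_def)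

lemma sum:
  assumes "finite I" "\<And>i. i \<in> I \<Longrightarrow> bounded (f i ` E)"
  shows "bounded ((\<lambda>x. \<Sum>i\<in>I. f i x) ` E) \<and> L (\<lambda>x. \<Sum>i\<in>I. f i x) = (\<Sum>i\<in>I. L (f i))"
  using assms
proof (induction I rule: finite_induct)
  case empty
  then show ?case using const[of 0] bounded_const[of 0] by simp
next
  case (insert i I)
  then show ?case by (auto simp: add intro: bounded_plus_comp)
qed

text \<open>\<open>L\<close> is 1-Lipschitz for the uniform norm on \<open>E\<close>, as needed for
  approximation by step functions.\<close>

lemma dist_le:
  assumes g: "bounded (g ` E)" and h: "bounded (h ` E)" and e: "\<And>x. x \<in> E \<Longrightarrow> \<bar>g x - h x\<bar> \<le> e"
  shows "\<bar>L g - L h\<bar> \<le> e"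
proof -
  note c = bounded_const[of e E]
  have "L g \<le> L (\<lambda>x. h x + e)"
    using e by (intro mono g bounded_plus_comp h c) (auto simp: abs_le_iff algebra_simps)
  moreover have "L h \<le> L (\<lambda>x. g x + e)"
    using e by (intro mono g bounded_plus_comp h c) (auto simp: abs_le_iff algebra_simps)
  ultimately show ?thesis using add[OF g c] add[OF h c] const[of e] by (simp add: abs_le_iff)
qed

section \<open>The content of a mean and its regular sets\<close>

definition content :: "'a set \<Rightarrow> real" where "content A = L (indicator A)"

lemma content_mono: "A \<inter> E \<subseteq> B \<Longrightarrow> content A \<le> content B"
  unfolding content_def by (intro mono bounded_indicator) (auto simp: indicator_def)

lemma content_empty: "content {} = 0"
proof -
  have "indicator {} = (\<lambda>x::'a. 0::real)" by (simp add: fun_eq_iff)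
  then show ?thesis using const[of 0] by (simp add: content_def)
qed

lemma content_nonneg: "0 \<le> content A"
  using content_mono[of "{}" A] content_empty by simp

lemma content_space: "content E = 1"
proof (rule antisym)
  have "indicator UNIV = (\<lambda>x::'a. 1::real)" by (simp add: fun_eq_iff)
  then have "content UNIV = 1" using one by (simp add: content_def)
  then show "content E \<le> 1" "1 \<le> content E" using content_mono[of E UNIV] content_mono[of UNIV E] by auto
qed

lemma content_Un_disjoint: "A \<inter> B = {} \<Longrightarrow> content (A \<union> B) = content A + content B"
  unfolding content_def add[OF bounded_indicator bounded_indicator, symmetric]
  by (rule arg_cong[of _ _ L]) (auto simp: indicator_def fun_eq_iff)

lemma content_Un_le: "content (A \<union> B) \<le> content A + content B"
  using content_Un_disjoint[of A "B - A"] content_mono[of "B - A" B] by auto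

lemma content_UN_le: "finite I \<Longrightarrow> content (\<Union>i\<in>I. A i) \<le> (\<Sum>i\<in>I. content (A i))"
proof (induction I rule: finite_induct)
  case (insert i I)
  then show ?case using content_Un_le[of "A i" "\<Union>i\<in>I. A i"] by simp
qed (simp add: content_empty)

text \<open>Regularity is a genuine restriction even for open sets: a finitely additive mean may put
  its mass in an open set arbitrarily near the boundary, where no compact subset meets it.\<close>

definition regular :: "'a set set" where
  "regular = {A. A \<subseteq> E \<and>
     (\<forall>e>0. \<exists>K U. compact K \<and> K \<subseteq> A \<and> A \<subseteq> U \<and> openin (top_of_set E) U \<and> content (U - K) < e)}"

lemma regularE:
  assumes "A \<in> regular" "0 < e"
  obtains K U where "compact K" "K \<subseteq> A" "A \<subseteq> U" "openin (top_of_set E) U" "content (U - K) < e"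
  using assms unfolding regular_def by blast

lemma regular_subset: "A \<in> regular \<Longrightarrow> A \<subseteq> E"
  unfolding regular_def by blast

lemma algebra_regular: "algebra E regular"
  unfolding algebra_iff_Un
proof (intro conjI ballI)
  show "regular \<subseteq> Pow E" by (auto simp: regular_def)
  show "{} \<in> regular"
    unfolding regular_def by (auto simp: content_empty intro!: exI[of _ "{}"])
next
  fix A assume A: "A \<in> regular"
  show "E - A \<in> regular"
    unfolding regular_def
  proof (intro CollectI conjI allI impI)
    fix e :: real assume "0 < e"
    then obtain K U where KU: "compact K" "K \<subseteq> A" "A \<subseteq> U" "openin (top_of_set E) U" "content (U - K) < e"
      using regularE[OF A] by blast
    have "compact (E - U)" by (rule compact_diff_openin[OF KU(4)])
    moreover have "openin (top_of_set E) (E - K)"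
      using openin_open_Int[of "- K" E] KU(1) by (simp add: Diff_eq compact_imp_closed open_Compl)
    moreover have "(E - K) - (E - U) = U - K" using openin_imp_subset[OF KU(4)] by blast
    ultimately show "\<exists>K U. compact K \<and> K \<subseteq> E - A \<and> E - A \<subseteq> U \<and> openin (top_of_set E) U \<and> content (U - K) < e"
      using KU by (intro exI[of _ "E - U"] exI[of _ "E - K"]) auto
  qed auto
next
  fix A B assume AB: "A \<in> regular" "B \<in> regular"
  show "A \<union> B \<in> regular"
    unfolding regular_def
  proof (intro CollectI conjI allI impI)
    show "A \<union> B \<subseteq> E" using AB by (auto simp: regular_def)
    fix e :: real assume "0 < e"
    then have e: "0 < e / 2" by simp
    obtain K U where KU: "compact K" "K \<subseteq> A" "A \<subseteq> U" "openin (top_of_set E) U" "content (U - K) < e / 2"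
      using regularE[OF AB(1) e] by blast
    obtain K' U' where KU': "compact K'" "K' \<subseteq> B" "B \<subseteq> U'" "openin (top_of_set E) U'" "content (U' - K') < e / 2"
      using regularE[OF AB(2) e] by blast
    have "content ((U \<union> U') - (K \<union> K')) \<le> content ((U - K) \<union> (U' - K'))"
      by (rule content_mono) blast
    also have "\<dots> < e" using content_Un_le[of "U - K" "U' - K'"] KU(5) KU'(5) by linarith
    finally show "\<exists>K U. compact K \<and> K \<subseteq> A \<union> B \<and> A \<union> B \<subseteq> U \<and> openin (top_of_set E) U \<and> content (U - K) < e"
      using KU KU' by (intro exI[of _ "K \<union> K'"] exI[of _ "U \<union> U'"]) auto
  qed
qed

text \<open>Compactness supplies continuity at the empty set. Inner compact sets \<open>K i\<close>
  with errors e/2^(i+1) have empty intersection, so finitely many of them already do. A point of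
  \<open>A N\<close> then misses some \<open>K i\<close> with i \<le> N although it lies in
  \<open>A i\<close>, so \<open>A N\<close> is covered by the errors.\<close>

lemma content_decreasing_tendsto_0:
  assumes A: "range A \<subseteq> regular" "decseq A" "(\<Inter>i. A i) = {}"
  shows "(\<lambda>i. content (A i)) \<longlonglongrightarrow> 0"
proof (rule LIMSEQ_I)
  fix e :: real assume e: "0 < e"
  have "\<exists>K. compact K \<and> K \<subseteq> A i \<and> content (A i - K) < e * (1/2) ^ Suc i" for i
  proof -
    have "A i \<in> regular" "0 < e * (1/2) ^ Suc i" using A e by auto
    then obtain K U where KU: "compact K" "K \<subseteq> A i" "A i \<subseteq> U" "content (U - K) < e * (1/2) ^ Suc i"
      by (rule regularE)
    moreover have "content (A i - K) \<le> content (U - K)" using KU(3) by (intro content_mono) blast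
    ultimately show ?thesis by (intro exI[of _ K]) auto
  qed
  then obtain K where K: "\<And>i. compact (K i)" "\<And>i. K i \<subseteq> A i" "\<And>i. content (A i - K i) < e * (1/2) ^ Suc i"
    by metis
  have AE: "A i \<subseteq> E" for i using A(1) by (intro regular_subset) blast
  have "\<exists>\<B>\<subseteq>range K. finite \<B> \<and> E \<inter> \<Inter> \<B> = {}"
  proof (rule ccontr)
    assume no: "\<not> ?thesis"
    have "E \<inter> \<Inter> (range K) \<noteq> {}"
    proof (rule compact_Int_Inter_nonempty[OF compact])
      fix S assume "S \<in> range K"
      then show "closed S" using compact_imp_closed[OF K(1)] by blast
    next
      fix \<B> assume "\<B> \<subseteq> range K" "finite \<B>"
      then show "E \<inter> \<Inter> \<B> \<noteq> {}" using no by blast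
    qed
    then obtain x where "\<And>i. x \<in> K i" by blast
    then have "x \<in> (\<Inter>i. A i)" using K(2) by blast
    then show False using A(3) by blast
  qed
  then obtain \<B> where B: "\<B> \<subseteq> range K" "finite \<B>" "E \<inter> \<Inter> \<B> = {}" by blast
  obtain I where I: "finite I" "\<B> = K ` I"
    using finite_subset_image[OF B(2,1)] by blast
  \<comment> \<open>Inserting 0 keeps \<open>Max\<close> meaningful when \<open>I\<close> is
    empty.\<close>
  define N where "N = Max (insert 0 I)"
  have IN: "i \<le> N" if "i \<in> I" for i using I(1) that by (simp add: N_def)
  have "A N \<subseteq> (\<Union>i\<in>{..N}. A i - K i)"
  proof
    fix x assume x: "x \<in> A N"
    then obtain i where i: "i \<in> I" "x \<notin> K i" using B(3) I(2) AE by blast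
    have "x \<in> A i" using x A(2) IN[OF i(1)] by (auto simp: decseq_def)
    then show "x \<in> (\<Union>i\<in>{..N}. A i - K i)" using i IN by blast
  qed
  then have "content (A N) \<le> content (\<Union>i\<in>{..N}. A i - K i)" by (intro content_mono) blast
  also have "\<dots> \<le> (\<Sum>i\<le>N. content (A i - K i))" by (rule content_UN_le) simp
  also have "\<dots> \<le> (\<Sum>i\<le>N. e * (1/2) ^ Suc i)" using K(3) by (intro sum_mono less_imp_le)
  also have "\<dots> = e * (1 - (1/2) ^ Suc N)"
    by (induction N) (simp_all add: algebra_simps)
  also have "\<dots> < e" using e by (simp add: algebra_simps)
  finally have N: "content (A N) < e" .
  have "norm (content (A i) - 0) < e" if "N \<le> i" for i
  proof -
    have "A i \<subseteq> A N" using A(2) that by (auto simp: decseq_def)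
    then have "content (A i) \<le> content (A N)" by (intro content_mono) blast
    then show ?thesis using N content_nonneg[of "A i"] by simp
  qed
  then show "\<exists>N. \<forall>i\<ge>N. norm (content (A i) - 0) < e" by blast
qed

lemma ex_measure_extension:
  "\<exists>\<mu>. (\<forall>A\<in>regular. \<mu> A = ennreal (content A)) \<and> measure_space E (sigma_sets E regular) \<mu>"
proof -
  interpret algebra E regular by (rule algebra_regular)
  show ?thesis
  proof (rule caratheodory_empty_continuous)
    show "positive regular (\<lambda>A. ennreal (content A))" by (simp add: positive_def content_empty)
    show "additive regular (\<lambda>A. ennreal (content A))"
      by (simp add: additive_def content_Un_disjoint content_nonneg ennreal_plus)
    show "(\<lambda>i. ennreal (content (A i))) \<longlonglongrightarrow> 0"
      if "range A \<subseteq> regular" "decseq A" "(\<Inter>i. A i) = {}" for A :: "nat \<Rightarrow> 'a set"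
      using tendsto_ennrealI[OF content_decreasing_tendsto_0[OF that]] by simp
  qed simp
qed

section \<open>Regular sets generate the Borel sets\<close>

lemma sublevel_openin:
  assumes "continuous_on E (g :: 'a \<Rightarrow> real)"
  shows "openin (top_of_set E) {x\<in>E. g x < t}"
proof -
  have "openin (top_of_set E) (E \<inter> g -` {..<t})"
    by (rule continuous_openin_preimage_gen[OF assms]) simp
  moreover have "E \<inter> g -` {..<t} = {x\<in>E. g x < t}" by auto
  ultimately show ?thesis by simp
qed

text \<open>The content of {g < t} is monotone in t, hence continuous at all but countably many t.
  At a continuity point the compact set {g \<le> t'}, with t' slightly below t, carries almost all
  of the content.\<close>

lemma regular_sublevel:
  assumes g: "continuous_on E (g :: 'a \<Rightarrow> real)" and ab: "a < b"
  obtains t where "a < t" "t < b" "{x\<in>E. g x < t} \<in> regular"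
proof -
  define G where "G = (\<lambda>t. content {x\<in>E. g x < t})"
  have "mono G" unfolding G_def by (intro monoI content_mono) auto
  then have "countable {t. \<not> isCont G t}" by (rule mono_ctble_discont)
  then have "\<not> {a<..<b} \<subseteq> {t. \<not> isCont G t}"
    using uncountable_open_interval[of a b] ab countable_subset by blast
  then obtain t where t: "a < t" "t < b" "isCont G t" by auto
  have "{x\<in>E. g x < t} \<in> regular"
    unfolding regular_def
  proof (intro CollectI conjI allI impI)
    fix e :: real assume e: "0 < e"
    obtain s where s: "0 < s" "\<And>t'. \<bar>t' - t\<bar> < s \<Longrightarrow> \<bar>G t' - G t\<bar> < e"
      using t(3) e unfolding continuous_at_eps_delta by (auto simp: dist_real_def)
    define t' where "t' = t - s / 2"
    have t': "t' < t" "\<bar>t' - t\<bar> < s" using s(1) by (auto simp: t'_def)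
    let ?K = "{x\<in>E. g x \<le> t'}" and ?U = "{x\<in>E. g x < t}"
    have "content ?U = content ((?U - ?K) \<union> ?K)" using t' by (intro arg_cong[of _ _ content]) auto
    also have "\<dots> = content (?U - ?K) + content ?K" by (rule content_Un_disjoint) auto
    finally have "content (?U - ?K) = G t - content ?K" by (simp add: G_def)
    also have "\<dots> \<le> G t - G t'" unfolding G_def by (intro diff_left_mono content_mono) auto
    also have "\<dots> < e" using s(2)[OF t'(2)] by (simp add: abs_less_iff)
    finally have "content (?U - ?K) < e" .
    then show "\<exists>K U. compact K \<and> K \<subseteq> ?U \<and> ?U \<subseteq> U \<and> openin (top_of_set E) U \<and> content (U - K) < e"
      using t' compact_level_set(2)[OF compact g] sublevel_openin[OF g]
      by (intro exI[of _ ?K] exI[of _ ?U]) auto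
  qed auto
  with t show ?thesis by (intro that)
qed

text \<open>Each compact piece \<open>K n\<close> of \<open>W\<close> is covered by finitely many
  regular \<open>\<delta>\<close>-balls contained in \<open>W\<close>. Their union is regular, and
  countably many such unions exhaust \<open>W\<close>.\<close>

lemma openin_in_sigma_regular:
  assumes W: "openin (top_of_set E) W"
  shows "W \<in> sigma_sets E regular"
proof -
  interpret algebra E regular by (rule algebra_regular)
  interpret S: sigma_algebra E "sigma_sets E regular"
    by (rule sigma_algebra_sigma_sets[OF space_closed])
  obtain K where K: "\<And>n. compact (K n)" "incseq K" "W = (\<Union>n. K n)"
    using openin_sigma_compact[OF W] by blast
  have WE: "W \<subseteq> E" using W openin_imp_subset by blast
  have "\<exists>A. A \<in> regular \<and> K n \<subseteq> A \<and> A \<subseteq> W" for n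
  proof -
    have "\<exists>A T. A \<in> regular \<and> A \<subseteq> W \<and> open T \<and> A = E \<inter> T \<and> x \<in> T" if x: "x \<in> W" for x
    proof -
      obtain r where r: "r > 0" "\<forall>z\<in>E - W. r \<le> \<delta> x z"
        using separated_from_closed[OF W x] by blast
      have xE: "x \<in> E" using x WE by blast
      then obtain t where t: "0 < t" "t < r" "{z\<in>E. \<delta> x z < t} \<in> regular"
        using regular_sublevel[OF continuous_on_left r(1)] by blast
      have "{z\<in>E. \<delta> x z < t} \<subseteq> W" using r(2) t(2) by force
      moreover obtain T where "open T" "{z\<in>E. \<delta> x z < t} = E \<inter> T"
        using sublevel_openin[OF continuous_on_left[OF xE]] unfolding openin_open by metis
      moreover have "x \<in> {z\<in>E. \<delta> x z < t}" using zero_iff[OF xE xE] xE t(1) by simp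
      ultimately show ?thesis using t(3) by (metis IntD2)
    qed
    then obtain A T where AT: "\<And>x. x \<in> W \<Longrightarrow> A x \<in> regular" "\<And>x. x \<in> W \<Longrightarrow> A x \<subseteq> W"
      "\<And>x. x \<in> W \<Longrightarrow> open (T x)" "\<And>x. x \<in> W \<Longrightarrow> A x = E \<inter> T x" "\<And>x. x \<in> W \<Longrightarrow> x \<in> T x"
      by metis
    have KW: "K n \<subseteq> W" using K(3) by blast
    have op: "open (T x)" if "x \<in> K n" for x using AT(3) KW that by blast
    have cov: "K n \<subseteq> (\<Union>x\<in>K n. T x)" using AT(5) KW by blast
    obtain D where D: "D \<subseteq> K n" "finite D" "K n \<subseteq> (\<Union>x\<in>D. T x)"
      using compactE_image[OF K(1) op cov] by metis
    have DW: "x \<in> W" if "x \<in> D" for x using D(1) KW that by blast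
    have "(\<Union>x\<in>D. A x) \<in> regular" using D(2) AT(1) DW by (intro finite_UN) auto
    moreover have "K n \<subseteq> (\<Union>x\<in>D. A x)"
    proof
      fix z assume z: "z \<in> K n"
      then obtain x where x: "x \<in> D" "z \<in> T x" using D(3) by blast
      have "z \<in> E" using z KW WE by blast
      then show "z \<in> (\<Union>x\<in>D. A x)" using x AT(4)[OF DW[OF x(1)]] by blast
    qed
    moreover have "(\<Union>x\<in>D. A x) \<subseteq> W" using AT(2) DW by blast
    ultimately show ?thesis by blast
  qed
  then obtain A where A: "\<And>n. A n \<in> regular" "\<And>n. K n \<subseteq> A n" "\<And>n. A n \<subseteq> W" by metis
  have "W = (\<Union>n. A n)" using K(3) A by blast
  moreover have "(\<Union>n. A n) \<in> sigma_sets E regular"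
    using A(1) by (intro sigma_sets.Union sigma_sets.Basic)
  ultimately show ?thesis by simp
qed

text \<open>The integral and \<open>L\<close> are compared through one step function built from
  regular sublevel sets, where measure and content agree; both differ from it by at most the
  mesh.\<close>

theorem Riesz_representation:
  "\<exists>M\<in>radon_prob E. \<forall>g. continuous_on E g \<longrightarrow> (\<integral>x. g x \<partial>M) = L g"
proof -
  let ?B = "restrict_space borel E"
  obtain \<mu> where \<mu>: "\<And>A. A \<in> regular \<Longrightarrow> \<mu> A = ennreal (content A)"
    "measure_space E (sigma_sets E regular) \<mu>"
    using ex_measure_extension by blast
  define N where "N = measure_of E (sigma_sets E regular) \<mu>"
  have pow: "sigma_sets E regular \<subseteq> Pow E"
    using \<mu>(2) by (auto simp: measure_space_def sigma_algebra_iff2)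
  have spN: "space N = E" using pow by (simp add: N_def space_measure_of)
  have setsN: "sets N = sigma_sets E regular"
    unfolding N_def using \<mu>(2) by (intro sigma_algebra.sets_measure_of_eq) (simp add: measure_space_def)
  have emN: "emeasure N A = ennreal (content A)" if "A \<in> regular" for A
    using \<mu> that unfolding N_def measure_space_def
    by (subst emeasure_measure_of_sigma) (auto intro: sigma_sets.Basic)
  \<comment> \<open>Regular sets need not be Borel, so the extension may live on a larger
    sigma-algebra; the push-forward under the identity restricts it to the Borel sets.\<close>
  define M where "M = distr N ?B (\<lambda>x. x)"
  have id: "(\<lambda>x. x) \<in> measurable N ?B"
  proof (rule measurableI)
    fix A assume "A \<in> sets ?B"
    then have "A \<in> sigma_sets E {W. openin (top_of_set E) W}" by (simp add: sets_restrict_borel)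
    then have "A \<in> sigma_sets E regular"
      using sigma_sets_mono[of "{W. openin (top_of_set E) W}" E regular] openin_in_sigma_regular by blast
    then show "(\<lambda>x. x) -` A \<inter> space N \<in> sets N"
      using setsN spN pow by (simp add: Int_absorb2 subset_eq)
  qed (simp add: spN space_restrict_borel)
  have setsM: "sets M = sets ?B" by (simp add: M_def)
  have E: "E \<in> regular"
    using algebra.top[OF algebra_regular] by simp
  have "prob_space N" using emN[OF E] content_space spN by (intro prob_spaceI) simp
  then have prob: "prob_space M" unfolding M_def by (rule prob_space.prob_space_distr[OF _ id])
  interpret prob_space M by fact
  have spM: "space M = E" by (simp add: M_def space_restrict_borel)
  have meas: "measure M A = content A" if "A \<in> regular" "A \<in> sets ?B" for A
    using emN[OF that(1)] sets.sets_into_space[OF that(2)] that(2) content_nonneg[of A]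
    by (simp add: measure_def M_def emeasure_distr[OF id] spN space_restrict_borel Int_absorb2)
  have "(\<integral>x. g x \<partial>M) = L g" if g: "continuous_on E g" for g
  proof -
    have bdd: "bounded (g ` E)"
      using compact_continuous_image[OF g compact] by (rule compact_imp_bounded)
    then obtain b where b: "\<And>x. x \<in> E \<Longrightarrow> \<bar>g x\<bar> < b" and b0: "0 < b"
      unfolding bounded_pos_less by auto
    have intg: "integrable M g"
      by (rule borel_prob_integrable[OF prob setsM compact g])
    have "\<bar>(\<integral>x. g x \<partial>M) - L g\<bar> \<le> 2 * e" if e: "0 < e" for e
    proof -
      obtain n :: nat where n: "2 * b / e \<le> real n" using real_arch_simple by blast
      \<comment> \<open>One level in each interval of length \<open>e\<close> above -b, shifted
        inside the interval so that its sublevel set is regular. The choice of \<open>n\<close>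
        makes the intervals cover the range of \<open>g\<close>.\<close>
      have "\<exists>t. - b + (real i - 1) * e < t \<and> t < - b + real i * e \<and> {x\<in>E. g x < t} \<in> regular" for i :: nat
        using regular_sublevel[OF g, of "- b + (real i - 1) * e" "- b + real i * e"] e
        by (auto simp: algebra_simps)
      then obtain t where t: "\<And>i. - b + (real i - 1) * e < t i" "\<And>i. t i < - b + real i * e"
        "\<And>i. {x\<in>E. g x < t i} \<in> regular" by metis
      define A where "A = (\<lambda>i. {x\<in>E. g x < t i})"
      define S where "S = (\<lambda>x. \<Sum>i\<in>{1..n}. indicator (A i) x :: real)"
      \<comment> \<open>\<open>S x\<close> counts the levels above \<open>g x\<close>, so n - S x
        counts those at or below it, and -b + (n - S x) e approximates \<open>g x\<close>.\<close>
      define S' where "S' = (\<lambda>x. (real n * e - b) + (- e) * S x)"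
      have close: "\<bar>g x - S' x\<bar> \<le> e" if x: "x \<in> E" for x
      proof -
        define y where "y = (g x + b) / e"
        have gx: "g x = y * e - b" using e by (simp add: y_def)
        have y: "0 \<le> y" "y \<le> real n"
        proof -
          show "0 \<le> y" using b[OF x] e by (simp add: y_def abs_less_iff)
          have "y \<le> 2 * b / e"
            unfolding y_def using b[OF x] e by (intro divide_right_mono) (auto simp: abs_less_iff)
          then show "y \<le> real n" using n by linarith
        qed
        define k where "k = card {i\<in>{1..n}. g x < t i}"
        have S: "S x = real k"
          using x by (simp add: S_def A_def k_def indicator_def sum.If_cases Int_def)
        \<comment> \<open>Levels with index at least q + 2 lie above \<open>g x\<close>, and those
          with index at most q do not. Only index q + 1 is undecided, so n - k is q or q +
          1.\<close>
        define q where "q = nat \<lfloor>y\<rfloor>"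
        have q: "real q \<le> y" "y < real q + 1" "q \<le> n"
          using y by (auto simp: q_def le_nat_floor nat_le_iff floor_le_iff intro: of_nat_floor)
        have "{q + 2..n} \<subseteq> {i\<in>{1..n}. g x < t i}"
        proof
          fix i assume i: "i \<in> {q + 2..n}"
          then have "y \<le> real i - 1" using q by auto
          then have "y * e \<le> (real i - 1) * e" using e by (intro mult_right_mono) auto
          then show "i \<in> {i\<in>{1..n}. g x < t i}" using t(1)[of i] gx i by auto
        qed
        then have "card {q + 2..n} \<le> k" unfolding k_def by (intro card_mono) auto
        then have k1: "n \<le> k + q + 1" by simp
        have "{i\<in>{1..n}. g x < t i} \<subseteq> {q + 1..n}"
        proof
          fix i assume i: "i \<in> {i\<in>{1..n}. g x < t i}"
          then have "y * e < real i * e" using t(2)[of i] gx by auto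
          then have "y < real i" using e by simp
          then have "q < i" using q by linarith
          then show "i \<in> {q + 1..n}" using i by auto
        qed
        then have "k \<le> card {q + 1..n}" unfolding k_def by (intro card_mono) auto
        then have k2: "k + q \<le> n" using q(3) by simp
        have "g x - S' x = (y - (real n - real k)) * e"
          by (simp add: S'_def S gx algebra_simps)
        moreover have "\<bar>y - (real n - real k)\<bar> \<le> 1"
          using k1 k2 q(1,2) by linarith
        ultimately show ?thesis using e by (simp add: abs_mult mult_left_le_one_le)
      qed
      have AB: "A i \<in> sets ?B" for i
        unfolding A_def by (intro openin_in_sets sublevel_openin g)
      have bS: "bounded (S ` E)" and LS: "L S = (\<Sum>i\<in>{1..n}. content (A i))"
        unfolding S_def content_def using sum[of "{1..n}" "\<lambda>i. indicator (A i)"] bounded_indicator by auto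
      have bS1: "bounded ((\<lambda>x. (- e) * S x) ` E)"
        using bounded_scaling[OF bS, of "- e"] by (simp add: image_image)
      note bc = bounded_const[of "real n * e - b" E]
      have bS': "bounded (S' ` E)"
        unfolding S'_def by (rule bounded_plus_comp[OF bc bS1])
      have LS': "L S' = (real n * e - b) + (- e) * (\<Sum>i\<in>{1..n}. content (A i))"
        unfolding S'_def add[OF bc bS1] cmult[OF bS] const LS ..
      have intA: "integrable M (indicator (A i) :: 'a \<Rightarrow> real)" for i
        using AB setsM by (intro integrable_real_indicator) (auto simp: emeasure_eq_measure)
      have intS: "integrable M S" unfolding S_def using intA by simp
      then have intS': "integrable M S'" unfolding S'_def by simp
      have "(\<integral>x. S x \<partial>M) = (\<Sum>i\<in>{1..n}. \<integral>x. indicator (A i) x \<partial>M)"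
        unfolding S_def using intA by simp
      also have "\<dots> = (\<Sum>i\<in>{1..n}. content (A i))"
        using AB setsM t(3) meas by (intro sum.cong refl) (auto simp: A_def)
      finally have "(\<integral>x. S' x \<partial>M) = (real n * e - b) + (- e) * (\<Sum>i\<in>{1..n}. content (A i))"
        unfolding S'_def using intS by (simp add: prob_space)
      then have "(\<integral>x. S' x \<partial>M) = L S'" by (simp only: LS')
      moreover have "\<bar>(\<integral>x. g x \<partial>M) - (\<integral>x. S' x \<partial>M)\<bar> \<le> e"
      proof -
        have "\<bar>(\<integral>x. g x \<partial>M) - (\<integral>x. S' x \<partial>M)\<bar> = \<bar>\<integral>x. g x - S' x \<partial>M\<bar>"
          using intg intS' by simp
        also have "\<dots> \<le> (\<integral>x. \<bar>g x - S' x\<bar> \<partial>M)"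
          using integral_norm_bound[of M "\<lambda>x. g x - S' x"] by simp
        also have "\<dots> \<le> (\<integral>x. e \<partial>M)"
          using close intg intS' spM by (intro integral_mono) auto
        finally show ?thesis by (simp add: prob_space)
      qed
      moreover have "\<bar>L g - L S'\<bar> \<le> e"
        by (rule dist_le[OF bdd bS' close])
      ultimately show ?thesis by linarith
    qed
    then have "\<bar>(\<integral>x. g x \<partial>M) - L g\<bar> \<le> e" if "0 < e" for e
      using that[THEN half_gt_zero] by fastforce
    then have "\<bar>(\<integral>x. g x \<partial>M) - L g\<bar> \<le> 0" by (rule field_le_epsilon[of _ 0, simplified])
    then show ?thesis by simp
  qed
  then show ?thesis using radon_probI[OF prob setsM] by blast
qed

end

section \<open>Representing measures and couplings\<close>

lemma bcontfun_discrete: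
  fixes h :: "'a discrete \<Rightarrow> real"
  assumes "bounded (range h)"
  shows "h \<in> bcontfun"
  using assms by (auto simp: bcontfun_def continuous_on_open_vimage[OF open_UNIV] open_discrete)

text \<open>
  Bounded functions on \<open>Ext C\<close> are encoded as bounded continuous functions on the discrete copy of
  the type, which form a real vector space. The functional \<open>q\<close> evaluates the upper envelope at \<open>x\<close>;
  it is finite because continuous linear forms attain their minimum over \<open>C\<close> on \<open>Ext C\<close>.
\<close>

lemma representing_measure_exists:
  fixes C :: "'a::{locally_convex_space, t2_space} set"
  assumes C: "compact C" "convex C" and ext: "compact_separated (Ext C) \<delta>" and x: "x \<in> C"
  shows "\<exists>M\<in>radon_prob (Ext C). \<forall>f\<in>continuous_dual. (\<integral>z. f z \<partial>M) = f x"
proof -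
  let ?E = "Ext C"
  interpret compact_separated "Ext C" \<delta> by fact
  define S where "S = (\<lambda>g :: 'a discrete \<Rightarrow>\<^sub>C real.
    {f x + c | f c. f \<in> continuous_dual \<and> (\<forall>e\<in>?E. apply_bcontfun g (discrete e) \<le> f e + c)})"
  define q where "q = (\<lambda>g. Inf (S g))"
  have low: "- norm g \<le> s" if s: "s \<in> S g" for s g
  proof -
    obtain f c where fc: "s = f x + c" "f \<in> continuous_dual"
      "\<And>e. e \<in> ?E \<Longrightarrow> apply_bcontfun g (discrete e) \<le> f e + c"
      using s unfolding S_def by blast
    obtain e where e: "e \<in> ?E" "f e \<le> f x"
      using continuous_dual_minimum_on_Ext[OF C fc(2) x] by blast
    have "- norm g \<le> apply_bcontfun g (discrete e)"
      using norm_bounded[of g "discrete e"] by simp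
    then show ?thesis using fc(3)[OF e(1)] e(2) fc(1) by linarith
  qed
  have ne: "S g \<noteq> {}" for g
  proof -
    have "apply_bcontfun g (discrete e) \<le> 0 + norm g" for e
      using norm_bounded[of g "discrete e"] by simp
    then have "0 + norm g \<in> S g"
      unfolding S_def using continuous_dual_zero
      by (intro CollectI exI[of _ "\<lambda>x. 0"] exI[of _ "norm g"]) simp
    then show ?thesis by blast
  qed
  have le: "q g \<le> f x + c"
    if "f \<in> continuous_dual" "\<And>e. e \<in> ?E \<Longrightarrow> apply_bcontfun g (discrete e) \<le> f e + c" for g f c
  proof -
    have "f x + c \<in> S g"
      unfolding S_def using that by (intro CollectI exI[of _ f] exI[of _ c]) simp
    then show ?thesis
      unfolding q_def using low by (intro cInf_lower bdd_belowI[of _ "- norm g"])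
  qed
  have ge: "b \<le> q g"
    if *: "\<And>f c. f \<in> continuous_dual \<Longrightarrow> (\<And>e. e \<in> ?E \<Longrightarrow> apply_bcontfun g (discrete e) \<le> f e + c) \<Longrightarrow> b \<le> f x + c"
    for b g
    unfolding q_def
  proof (rule cInf_greatest[OF ne])
    fix s assume "s \<in> S g"
    then obtain f c where "s = f x + c" "f \<in> continuous_dual"
      "\<And>e. e \<in> ?E \<Longrightarrow> apply_bcontfun g (discrete e) \<le> f e + c"
      unfolding S_def by blast
    then show "b \<le> s" using *[of f c] by simp
  qed
  have "sublinear q"
    unfolding sublinear_def
  proof (intro conjI allI impI)
    fix g h :: "'a discrete \<Rightarrow>\<^sub>C real"
    have "q (g + h) - q h \<le> q g"
    proof (rule ge)
      fix f c assume f: "f \<in> continuous_dual" "\<And>e. e \<in> ?E \<Longrightarrow> apply_bcontfun g (discrete e) \<le> f e + c"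
      have "q (g + h) - (f x + c) \<le> q h"
      proof (rule ge)
        fix f' c' assume f': "f' \<in> continuous_dual" "\<And>e. e \<in> ?E \<Longrightarrow> apply_bcontfun h (discrete e) \<le> f' e + c'"
        have "q (g + h) \<le> (f x + f' x) + (c + c')"
        proof (rule le)
          show "(\<lambda>z. f z + f' z) \<in> continuous_dual" by (rule continuous_dual_add[OF f(1) f'(1)])
          show "apply_bcontfun (g + h) (discrete e) \<le> f e + f' e + (c + c')" if "e \<in> ?E" for e
            using f(2)[OF that] f'(2)[OF that] by (simp add: plus_bcontfun.rep_eq)
        qed
        then show "q (g + h) - (f x + c) \<le> f' x + c'" by simp
      qed
      then show "q (g + h) - q h \<le> f x + c" by simp
    qed
    then show "q (g + h) \<le> q g + q h" by simp
  next
    fix t :: real and g :: "'a discrete \<Rightarrow>\<^sub>C real" assume t: "0 < t"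
    have "q (t *\<^sub>R g) / t \<le> q g"
    proof (rule ge)
      fix f c assume f: "f \<in> continuous_dual" "\<And>e. e \<in> ?E \<Longrightarrow> apply_bcontfun g (discrete e) \<le> f e + c"
      have "q (t *\<^sub>R g) \<le> t * f x + t * c"
      proof (rule le)
        show "(\<lambda>z. t * f z) \<in> continuous_dual" by (rule continuous_dual_cmult[OF f(1)])
        show "apply_bcontfun (t *\<^sub>R g) (discrete e) \<le> t * f e + t * c" if "e \<in> ?E" for e
          using mult_left_mono[OF f(2)[OF that], of t] t by (simp add: scaleR_bcontfun.rep_eq algebra_simps)
      qed
      then show "q (t *\<^sub>R g) / t \<le> f x + c" using t by (simp add: field_simps)
    qed
    then show "q (t *\<^sub>R g) \<le> t * q g" using t by (simp add: field_simps)
  qed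
  then obtain \<Lambda> where \<Lambda>: "linear \<Lambda>" "\<And>g. \<Lambda> g \<le> q g"
    using Hahn_Banach_sublinear by blast
  \<comment> \<open>Extension by zero off \<open>Ext C\<close> makes a function bounded on
    \<open>Ext C\<close> bounded on the whole type.\<close>
  define emb :: "('a \<Rightarrow> real) \<Rightarrow> ('a discrete \<Rightarrow>\<^sub>C real)"
    where "emb = (\<lambda>h. Bcontfun (\<lambda>z. if of_discrete z \<in> ?E then h (of_discrete z) else 0))"
  have emb: "apply_bcontfun (emb h) z = (if of_discrete z \<in> ?E then h (of_discrete z) else 0)"
    if "bounded (h ` ?E)" for h z
  proof -
    have "range (\<lambda>z. if of_discrete z \<in> ?E then h (of_discrete z) else 0) \<subseteq> insert 0 (h ` ?E)"
      by auto
    then have "bounded (range (\<lambda>z. if of_discrete z \<in> ?E then h (of_discrete z) else 0))"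
      using that by (meson bounded_insert bounded_subset)
    then show ?thesis
      unfolding emb_def by (subst Bcontfun_inverse) (auto intro: bcontfun_discrete)
  qed
  define L where "L = (\<lambda>h. \<Lambda> (emb h))"
  have upper: "L h \<le> f x + c"
    if "bounded (h ` ?E)" "f \<in> continuous_dual" "\<And>e. e \<in> ?E \<Longrightarrow> h e \<le> f e + c" for h f c
  proof -
    have "q (emb h) \<le> f x + c"
      using that by (intro le) (auto simp: emb discrete_inverse)
    then show ?thesis using \<Lambda>(2)[of "emb h"] by (simp add: L_def)
  qed
  have L_add: "L (\<lambda>x. g x + h x) = L g + L h" if "bounded (g ` ?E)" "bounded (h ` ?E)" for g h
  proof -
    have "emb (\<lambda>x. g x + h x) = emb g + emb h"
      using that by (intro bcontfun_eqI) (simp add: emb bounded_plus_comp plus_bcontfun.rep_eq)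
    then show ?thesis by (simp add: L_def linear_add[OF \<Lambda>(1)])
  qed
  have bounded_cmult: "bounded ((\<lambda>x. c * g x) ` ?E)" if "bounded (g ` ?E)" for c :: real and g
    using bounded_scaling[OF that, of c] by (simp add: image_image)
  have L_cmult: "L (\<lambda>x. c * g x) = c * L g" if "bounded (g ` ?E)" for c g
  proof -
    have "emb (\<lambda>x. c * g x) = c *\<^sub>R emb g"
      using that bounded_cmult[OF that] by (intro bcontfun_eqI) (simp add: emb scaleR_bcontfun.rep_eq)
    then show ?thesis by (simp add: L_def linear_cmul[OF \<Lambda>(1)])
  qed
  interpret mean_on_bounded "Ext C" \<delta> L
  proof
    fix g h :: "'a \<Rightarrow> real" assume gh: "bounded (g ` ?E)" "bounded (h ` ?E)" "\<And>x. x \<in> ?E \<Longrightarrow> g x \<le> h x"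
    \<comment> \<open>The zero form is an affine majorant of the nonpositive difference.\<close>
    have "L (\<lambda>x. g x + (-1) * h x) \<le> 0 + 0"
      using gh by (intro upper[of _ "\<lambda>x. 0"] bounded_plus_comp bounded_cmult continuous_dual_zero) auto
    then show "L g \<le> L h"
      by (simp only: L_add[OF gh(1) bounded_cmult[OF gh(2)]] L_cmult[OF gh(2)])
  next
    have b: "bounded ((\<lambda>x. c :: real) ` ?E)" for c
      by (rule bounded_subset[of "{c}"]) auto
    have "L (\<lambda>x. 1) \<le> 0 + 1"
      by (intro upper[of _ "\<lambda>x. 0"] b continuous_dual_zero) auto
    moreover have "L (\<lambda>x. -1) \<le> 0 + (-1)"
      by (intro upper[of _ "\<lambda>x. 0"] b continuous_dual_zero) auto
    ultimately show "L (\<lambda>x. 1) = 1"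
      using L_cmult[OF b, of "-1" 1] by simp
  qed (use L_add L_cmult in auto)
  obtain M where M: "M \<in> radon_prob ?E" "\<And>g. continuous_on ?E g \<Longrightarrow> (\<integral>z. g z \<partial>M) = L g"
    using Riesz_representation by blast
  have "(\<integral>z. f z \<partial>M) = f x" if f: "f \<in> continuous_dual" for f
  proof -
    have cont: "continuous_on ?E f" by (rule continuous_dualD(2)[OF f])
    have bdd: "bounded (f ` ?E)"
      using compact_continuous_image[OF cont compact] by (rule compact_imp_bounded)
    \<comment> \<open>Both \<open>f\<close> and its negative are their own majorants, which bounds
      \<open>L f\<close> by \<open>f x\<close> from both sides.\<close>
    have "L f \<le> f x + 0" using f bdd by (intro upper) auto
    moreover have "L (\<lambda>x. (-1) * f x) \<le> (-1) * f x + 0"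
      using f by (intro upper bounded_cmult[OF bdd] continuous_dual_cmult) auto
    ultimately have "L f = f x" using L_cmult[OF bdd, of "-1"] by simp
    then show ?thesis using M(2)[OF cont] by simp
  qed
  then show ?thesis using M(1) by blast
qed

section \<open>Push-forwards and couplings\<close>

context compact_separated
begin

text \<open>Makes the regularity results available on \<open>E \<times> E\<close> with the Borel
  sets of the product topology.\<close>

lemma compact_separated_Times:
  "compact_separated (E \<times> E) (\<lambda>u v. \<delta> (fst u) (fst v) + \<delta> (snd u) (snd v))"
proof
  show "compact (E \<times> E)" by (intro compact_Times compact)
  have "continuous_on ((E \<times> E) \<times> E \<times> E) (\<lambda>w. \<delta> (fst (fst (fst w), fst (snd w))) (snd (fst (fst w), fst (snd w))))"
    by (rule continuous_on_compose2[OF continuous]) (auto intro!: continuous_intros)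
  moreover have "continuous_on ((E \<times> E) \<times> E \<times> E) (\<lambda>w. \<delta> (fst (snd (fst w), snd (snd w))) (snd (snd (fst w), snd (snd w))))"
    by (rule continuous_on_compose2[OF continuous]) (auto intro!: continuous_intros)
  ultimately show "continuous_on ((E \<times> E) \<times> E \<times> E)
    (\<lambda>w. \<delta> (fst (fst w)) (fst (snd w)) + \<delta> (snd (fst w)) (snd (snd w)))"
    by (simp add: continuous_on_add)
next
  fix u v assume uv: "u \<in> E \<times> E" "v \<in> E \<times> E"
  have nn: "0 \<le> \<delta> (fst u) (fst v)" "0 \<le> \<delta> (snd u) (snd v)"
    using uv by (auto intro: nonneg)
  then show "0 \<le> \<delta> (fst u) (fst v) + \<delta> (snd u) (snd v)" by simp
  show "\<delta> (fst u) (fst v) + \<delta> (snd u) (snd v) = 0 \<longleftrightarrow> u = v"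
    using nn uv zero_iff by (auto simp: add_nonneg_eq_0_iff prod_eq_iff)
qed

lemma radon_prob_distr:
  assumes F: "compact_separated F \<delta>'" and \<mu>: "\<mu> \<in> radon_prob E"
    and \<phi>: "continuous_on E \<phi>" "\<phi> \<in> E \<rightarrow> F"
  shows "\<phi> \<in> measurable \<mu> (restrict_space borel F)"
    and "distr \<mu> (restrict_space borel F) \<phi> \<in> radon_prob F"
proof -
  interpret F: compact_separated F \<delta>' by fact
  have \<mu>': "prob_space \<mu>" "sets \<mu> = sets (restrict_space borel E)"
    using \<mu> by (auto simp: radon_prob_def)
  have "\<phi> \<in> measurable (restrict_space borel E) (restrict_space borel F)"
    using \<phi> by (intro measurable_restrict_space2 borel_measurable_continuous_on_restrict)
      (auto simp: space_restrict_space)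
  then show meas: "\<phi> \<in> measurable \<mu> (restrict_space borel F)"
    using \<mu>'(2) by (simp cong: measurable_cong_sets)
  show "distr \<mu> (restrict_space borel F) \<phi> \<in> radon_prob F"
    by (rule F.radon_probI) (simp_all add: prob_space.prob_space_distr[OF \<mu>'(1) meas])
qed

text \<open>The product measure is a coupling once the Borel sets of \<open>E \<times> E\<close> are
  product measurable. An open set there is a countable union of compact sets, and each of these is
  covered by finitely many open rectangles inside the open set.\<close>

lemma couplings_nonempty:
  assumes \<mu>: "\<mu> \<in> radon_prob E" and \<nu>: "\<nu> \<in> radon_prob E"
  shows "couplings E \<mu> \<nu> \<noteq> {}"
proof -
  let ?B = "restrict_space borel E" and ?BB = "restrict_space borel (E \<times> E)"
  interpret EE: compact_separated "E \<times> E" "\<lambda>u v. \<delta> (fst u) (fst v) + \<delta> (snd u) (snd v)"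
    by (rule compact_separated_Times)
  have s: "sets \<mu> = sets ?B" "sets \<nu> = sets ?B" using \<mu> \<nu> by (auto simp: radon_prob_def)
  have sp: "space \<mu> = E" "space \<nu> = E"
    using s[THEN sets_eq_imp_space_eq] space_restrict_borel by auto
  interpret \<mu>: prob_space \<mu> using \<mu> by (simp add: radon_prob_def)
  interpret \<nu>: prob_space \<nu> using \<nu> by (simp add: radon_prob_def)
  interpret P: pair_prob_space \<mu> \<nu> ..
  have spP: "space (\<mu> \<Otimes>\<^sub>M \<nu>) = E \<times> E" by (simp add: space_pair_measure sp)
  have "W \<in> sets (\<mu> \<Otimes>\<^sub>M \<nu>)" if W: "openin (top_of_set (E \<times> E)) W" for W
  proof -
    obtain K :: "nat \<Rightarrow> _" where K: "\<And>n. compact (K n)" "W = (\<Union>n. K n)"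
      using EE.openin_sigma_compact[OF W] by blast
    obtain T where T: "open T" "W = (E \<times> E) \<inter> T" 
      using W unfolding openin_open by blast
    have "\<exists>R\<in>sets (\<mu> \<Otimes>\<^sub>M \<nu>). K n \<subseteq> R \<and> R \<subseteq> W" for n
    proof -
      have KW: "K n \<subseteq> W" using K(2) by blast
      have "\<exists>A B. open A \<and> open B \<and> w \<in> A \<times> B \<and> A \<times> B \<subseteq> T" if "w \<in> K n" for w
      proof -
        have "w \<in> T" using that KW T(2) by blast
        from open_prod_elim[OF T(1) this] show ?thesis by metis
      qed
      then obtain A B where AB: "\<And>w. w \<in> K n \<Longrightarrow> open (A w)" "\<And>w. w \<in> K n \<Longrightarrow> open (B w)"
        "\<And>w. w \<in> K n \<Longrightarrow> w \<in> A w \<times> B w" "\<And>w. w \<in> K n \<Longrightarrow> A w \<times> B w \<subseteq> T"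
        by metis
      have op: "open (A w \<times> B w)" if "w \<in> K n" for w using AB that by (intro open_Times)
      have cov: "K n \<subseteq> (\<Union>w\<in>K n. A w \<times> B w)" using AB(3) by blast
      obtain D where D: "D \<subseteq> K n" "finite D" "K n \<subseteq> (\<Union>w\<in>D. A w \<times> B w)"
        using compactE_image[OF K(1) op cov] by metis
      define R where "R = (\<Union>w\<in>D. (E \<inter> A w) \<times> (E \<inter> B w))"
      have "(E \<inter> A w) \<times> (E \<inter> B w) \<in> sets (\<mu> \<Otimes>\<^sub>M \<nu>)" if "w \<in> D" for w
      proof -
        have "w \<in> K n" using D(1) that by blast
        then show ?thesis
          using AB(1,2) s by (intro pair_measureI) (simp_all add: openin_in_sets openin_open_Int)
      qed
      then have "R \<in> sets (\<mu> \<Otimes>\<^sub>M \<nu>)" using D(2) by (auto simp: R_def)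
      moreover have "K n \<subseteq> R" using D(3) KW T(2) unfolding R_def by fastforce
      moreover have "R \<subseteq> W" using AB(4) D(1) T(2) unfolding R_def by fastforce
      ultimately show ?thesis by blast
    qed
    then obtain R where R: "\<And>n. R n \<in> sets (\<mu> \<Otimes>\<^sub>M \<nu>)" "\<And>n. K n \<subseteq> R n" "\<And>n. R n \<subseteq> W" by metis
    have "W = (\<Union>n. R n)" using R K(2) by blast
    then show ?thesis using R(1) by blast
  qed
  then have "sigma_sets (space (\<mu> \<Otimes>\<^sub>M \<nu>)) {W. openin (top_of_set (E \<times> E)) W} \<subseteq> sets (\<mu> \<Otimes>\<^sub>M \<nu>)"
    by (intro sets.sigma_sets_subset) auto
  then have "sets ?BB \<subseteq> sets (\<mu> \<Otimes>\<^sub>M \<nu>)"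
    by (simp only: EE.sets_restrict_borel spP)
  then have id: "(\<lambda>w. w) \<in> measurable (\<mu> \<Otimes>\<^sub>M \<nu>) ?BB"
    by (intro measurableI) (auto simp: spP space_restrict_space Int_absorb2 dest: sets.sets_into_space)
  define \<pi> where "\<pi> = distr (\<mu> \<Otimes>\<^sub>M \<nu>) ?BB (\<lambda>w. w)"
  have \<pi>: "\<pi> \<in> radon_prob (E \<times> E)"
    unfolding \<pi>_def by (rule EE.radon_probI) (simp_all add: P.prob_space_distr[OF id])
  have meas: "fst \<in> measurable ?BB ?B" "snd \<in> measurable ?BB ?B"
    by (intro measurable_restrict_space2 borel_measurable_continuous_on_restrict continuous_intros;
        auto simp: space_restrict_space)+
  have "distr \<pi> ?B fst = distr (\<mu> \<Otimes>\<^sub>M \<nu>) \<mu> fst"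
    unfolding \<pi>_def distr_distr[OF meas(1) id] comp_def using s by (intro distr_cong) auto
  also have "\<dots> = \<mu>" by (rule \<nu>.distr_pair_fst)
  finally have fst: "distr \<pi> ?B fst = \<mu>" .
  have "distr \<pi> ?B snd = distr (\<mu> \<Otimes>\<^sub>M \<nu>) \<nu> snd"
    unfolding \<pi>_def distr_distr[OF meas(2) id] comp_def using s by (intro distr_cong) auto
  \<comment> \<open>Swapping the factors reduces the second marginal to the first.\<close>
  also have "\<dots> = distr (distr (\<nu> \<Otimes>\<^sub>M \<mu>) (\<mu> \<Otimes>\<^sub>M \<nu>) (\<lambda>(x, y). (y, x))) \<nu> snd"
    by (subst P.distr_pair_swap) simp
  also have "\<dots> = distr (\<nu> \<Otimes>\<^sub>M \<mu>) \<nu> fst"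
    by (subst distr_distr) (auto intro!: distr_cong simp: measurable_pair_swap')
  also have "\<dots> = \<nu>" by (rule \<mu>.distr_pair_fst)
  finally have "distr \<pi> ?B snd = \<nu>" .
  then show ?thesis using \<pi> fst by (auto simp: couplings_def)
qed

end

section \<open>Largest pseudo-distances\<close>

definition chain_sums :: "'a set \<Rightarrow> ('a \<Rightarrow> 'a \<Rightarrow> real) \<Rightarrow> 'a \<Rightarrow> 'a \<Rightarrow> real set" where
  "chain_sums C c x y = {(\<Sum>j=1..N. c (z j) (z (j + 1))) | (N::nat) (z::nat \<Rightarrow> 'a).
     N \<ge> 1 \<and> z 1 = x \<and> z (N + 1) = y \<and> (\<forall>j\<in>{1..N + 1}. z j \<in> C)}"

lemma chain_sumsI:
  fixes N :: nat
  assumes "N \<ge> 1" "z 1 = x" "z (N + 1) = y" "\<And>j. 1 \<le> j \<Longrightarrow> j \<le> N + 1 \<Longrightarrow> z j \<in> C"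
  shows "(\<Sum>j=1..N. c (z j) (z (j + 1))) \<in> chain_sums C c x y"
  unfolding chain_sums_def using assms by (intro CollectI exI[of _ N] exI[of _ z]) auto

lemma chain_sumsE:
  assumes "s \<in> chain_sums C c x y"
  obtains N :: nat and z where "N \<ge> 1" "z 1 = x" "z (N + 1) = y" "\<And>j. 1 \<le> j \<Longrightarrow> j \<le> N + 1 \<Longrightarrow> z j \<in> C"
    "s = (\<Sum>j=1..N. c (z j) (z (j + 1)))"
  using assms unfolding chain_sums_def by auto

lemma chain_sums_single:
  assumes "x \<in> C" "y \<in> C"
  shows "c x y \<in> chain_sums C c x y"
  using chain_sumsI[of 1 "\<lambda>j. if j = 1 then x else y" x y C c] assms by simp

lemma chain_sums_append:
  assumes "s \<in> chain_sums C c x y" "t \<in> chain_sums C c y w"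
  shows "s + t \<in> chain_sums C c x w"
proof -
  obtain N :: nat and z where z: "N \<ge> 1" "z 1 = x" "z (N + 1) = y" "\<And>j. 1 \<le> j \<Longrightarrow> j \<le> N + 1 \<Longrightarrow> z j \<in> C"
    "s = (\<Sum>j=1..N. c (z j) (z (j + 1)))"
    using chain_sumsE[OF assms(1)] by blast
  obtain M :: nat and v where v: "M \<ge> 1" "v 1 = y" "v (M + 1) = w" "\<And>j. 1 \<le> j \<Longrightarrow> j \<le> M + 1 \<Longrightarrow> v j \<in> C"
    "t = (\<Sum>j=1..M. c (v j) (v (j + 1)))"
    using chain_sumsE[OF assms(2)] by blast
  \<comment> \<open>The two chains share the point with index N + 1, where \<open>z (N + 1)\<close>
    and \<open>v 1\<close> both equal \<open>y\<close>; so \<open>u\<close> agrees with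
    \<open>z\<close> up to that index and with the shifted \<open>v\<close> from it on.\<close>
  define u where "u = (\<lambda>j. if j \<le> N then z j else v (j - N))"
  have u_z: "u j = z j" if "j \<le> N + 1" for j
    using that z(3) v(2) by (cases "j \<le> N") (auto simp: u_def le_Suc_eq)
  have u_v: "u (N + j) = v j" if "1 \<le> j" for j
    using that by (simp add: u_def)
  have "(\<Sum>j=1..N+M. c (u j) (u (j + 1)))
      = (\<Sum>j=1..N. c (u j) (u (j + 1))) + (\<Sum>j=N+1..N+M. c (u j) (u (j + 1)))"
    using z(1) by (intro sum.ub_add_nat) simp
  also have "(\<Sum>j=N+1..N+M. c (u j) (u (j + 1))) = (\<Sum>j=1..M. c (u (N + j)) (u (N + (j + 1))))"
    using sum.shift_bounds_cl_nat_ivl[of "\<lambda>j. c (u j) (u (j + 1))" 1 N M] by (simp add: add.commute)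
  also have "\<dots> = t"
    unfolding v(5) by (intro sum.cong refl) (simp add: u_v del: add_Suc_right)
  also have "(\<Sum>j=1..N. c (u j) (u (j + 1))) = s"
    unfolding z(5) by (intro sum.cong refl) (simp add: u_z)
  finally have "s + t = (\<Sum>j=1..N+M. c (u j) (u (j + 1)))" by simp
  moreover have "(\<Sum>j=1..N+M. c (u j) (u (j + 1))) \<in> chain_sums C c x w"
  proof (rule chain_sumsI)
    show "1 \<le> N + M" using z(1) by simp
    show "u 1 = x" using u_z[of 1] z(1,2) by simp
    show "u (N + M + 1) = w" using u_v[of "M + 1"] v(3) by simp
    show "u j \<in> C" if "1 \<le> j" "j \<le> N + M + 1" for j
      using that z(4)[of j] v(4)[of "j - N"] by (auto simp: u_def)
  qed
  ultimately show ?thesis by simp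
qed

lemma chain_sums_reverse:
  assumes sym: "\<And>x y. x \<in> C \<Longrightarrow> y \<in> C \<Longrightarrow> c x y = c y x" and s: "s \<in> chain_sums C c x y"
  shows "s \<in> chain_sums C c y x"
proof -
  obtain N :: nat and z where z: "N \<ge> 1" "z 1 = x" "z (N + 1) = y" "\<And>j. 1 \<le> j \<Longrightarrow> j \<le> N + 1 \<Longrightarrow> z j \<in> C"
    "s = (\<Sum>j=1..N. c (z j) (z (j + 1)))"
    using chain_sumsE[OF s] by blast
  \<comment> \<open>j \<mapsto> N + 2 - j reverses the N + 1 points; the N links are reversed by j
    \<mapsto> N + 1 - j.\<close>
  define u where "u = (\<lambda>j. z (N + 2 - j))"
  have "s = (\<Sum>j=1..N. c (z (N + 1 - j)) (z (N + 1 - j + 1)))"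
    unfolding z(5) by (rule sum.atLeastAtMost_rev[of "\<lambda>j. c (z j) (z (j + 1))"])
  also have "\<dots> = (\<Sum>j=1..N. c (u j) (u (j + 1)))"
  proof (intro sum.cong refl)
    fix j assume j: "j \<in> {1..N}"
    then have "u j = z (N + 1 - j + 1)" "u (j + 1) = z (N + 1 - j)"
      by (auto simp: u_def intro!: arg_cong[of _ _ z])
    then show "c (z (N + 1 - j)) (z (N + 1 - j + 1)) = c (u j) (u (j + 1))"
      using j by (simp only:) (intro sym z(4); auto)
  qed
  also have "\<dots> \<in> chain_sums C c y x"
    using z by (intro chain_sumsI) (auto simp: u_def)
  finally show ?thesis .
qed

text \<open>Iterated triangle inequality, giving maximality of the chain infimum. Applied to the
  zero pseudo-distance it also shows that chain sums are nonnegative.\<close>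

lemma pseudo_distance_le_chain_sum:
  assumes \<delta>: "pseudo_distance_on C \<delta>" "\<And>x y. x \<in> C \<Longrightarrow> y \<in> C \<Longrightarrow> \<delta> x y \<le> c x y"
    and s: "s \<in> chain_sums C c x y"
  shows "\<delta> x y \<le> s"
proof -
  obtain N :: nat and z where z: "N \<ge> 1" "z 1 = x" "z (N + 1) = y" "\<And>j. 1 \<le> j \<Longrightarrow> j \<le> N + 1 \<Longrightarrow> z j \<in> C"
    "s = (\<Sum>j=1..N. c (z j) (z (j + 1)))"
    using chain_sumsE[OF s] by blast
  have "\<delta> (z 1) (z (n + 1)) \<le> (\<Sum>j=1..n. c (z j) (z (j + 1)))" if "n \<le> N" for n
    using that
  proof (induction n)
    case 0
    then show ?case using \<delta>(1) z(4)[of 1] by (simp add: pseudo_distance_on_def)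
  next
    case (Suc n)
    have C: "z 1 \<in> C" "z (n + 1) \<in> C" "z (Suc n + 1) \<in> C"
      using Suc.prems by (auto intro: z(4))
    have "\<delta> (z 1) (z (Suc n + 1)) \<le> \<delta> (z 1) (z (n + 1)) + \<delta> (z (n + 1)) (z (Suc n + 1))"
      using \<delta>(1) C unfolding pseudo_distance_on_def by blast
    also have "\<dots> \<le> (\<Sum>j=1..n. c (z j) (z (j + 1))) + c (z (n + 1)) (z (Suc n + 1))"
      using Suc \<delta>(2)[OF C(2,3)] by (intro add_mono) auto
    finally show ?case by simp
  qed
  from this[of N] show ?thesis using z by simp
qed

lemma largest_pseudo_distance_below_Inf_chain_sums:
  assumes nonneg: "\<And>x y. x \<in> C \<Longrightarrow> y \<in> C \<Longrightarrow> 0 \<le> c x y"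
    and sym: "\<And>x y. x \<in> C \<Longrightarrow> y \<in> C \<Longrightarrow> c x y = c y x"
    and zero: "\<And>x. x \<in> C \<Longrightarrow> c x x = 0"
  shows "largest_pseudo_distance_below C c (\<lambda>x y. Inf (chain_sums C c x y))"
proof -
  have s0: "0 \<le> s" if "s \<in> chain_sums C c x y" for s x y
  proof (rule pseudo_distance_le_chain_sum[of C "\<lambda>x y. 0", OF _ _ that])
    show "pseudo_distance_on C (\<lambda>x y. 0)" by (simp add: pseudo_distance_on_def)
  qed (use nonneg in auto)
  have bdd: "bdd_below (chain_sums C c x y)" for x y
    using s0 by (intro bdd_belowI[of _ 0])
  have ne: "chain_sums C c x y \<noteq> {}" if "x \<in> C" "y \<in> C" for x y
    using chain_sums_single[OF that, of c] by blast
  have le: "Inf (chain_sums C c x y) \<le> s" if "s \<in> chain_sums C c x y" for s x y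
    by (rule cInf_lower[OF that bdd])
  have nn: "0 \<le> Inf (chain_sums C c x y)" if "x \<in> C" "y \<in> C" for x y
    using ne[OF that] s0 by (intro cInf_greatest)
  have below: "Inf (chain_sums C c x y) \<le> c x y" if "x \<in> C" "y \<in> C" for x y
    by (rule le[OF chain_sums_single[OF that]])
  have "pseudo_distance_on C (\<lambda>x y. Inf (chain_sums C c x y))"
    unfolding pseudo_distance_on_def
  proof (intro conjI ballI)
    fix x y assume xy: "x \<in> C" "y \<in> C"
    show "0 \<le> Inf (chain_sums C c x y)" by (rule nn[OF xy])
    have "chain_sums C c x y = chain_sums C c y x"
      using chain_sums_reverse[of C c, OF sym] by blast
    then show "Inf (chain_sums C c x y) = Inf (chain_sums C c y x)" by simp
  next
    fix x assume x: "x \<in> C"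
    show "Inf (chain_sums C c x x) = 0"
      using below[OF x x] nn[OF x x] zero[OF x] by simp
  next
    fix x y z assume xyz: "x \<in> C" "y \<in> C" "z \<in> C"
    have "Inf (chain_sums C c x z) - t \<le> Inf (chain_sums C c x y)" if t: "t \<in> chain_sums C c y z" for t
      using le[OF chain_sums_append[OF _ t]] ne[OF xyz(1,2)]
      by (intro cInf_greatest) (auto simp: diff_le_eq)
    then have "Inf (chain_sums C c x z) - Inf (chain_sums C c x y) \<le> Inf (chain_sums C c y z)"
      using ne[OF xyz(2,3)] by (intro cInf_greatest) (auto simp: diff_le_eq add.commute)
    then show "Inf (chain_sums C c x z) \<le> Inf (chain_sums C c x y) + Inf (chain_sums C c y z)" by simp
  qed
  moreover have "\<delta> x y \<le> Inf (chain_sums C c x y)"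
    if "pseudo_distance_on C \<delta>" "\<forall>x\<in>C. \<forall>y\<in>C. \<delta> x y \<le> c x y" "x \<in> C" "y \<in> C" for \<delta> x y
    using ne[OF that(3,4)] pseudo_distance_le_chain_sum[of C \<delta> c] that(1,2)
    by (intro cInf_greatest) auto
  ultimately show ?thesis
    using below unfolding largest_pseudo_distance_below_def by blast
qed

section \<open>The convex roof\<close>

text \<open>Stability of \<open>C\<close> enters through the compactness of \<open>Ext C\<close>
  contained in \<open>separated\<close>.\<close>

locale stable_roof =
  fixes C :: "'a::{locally_convex_space, t2_space} set" and d :: "'a \<Rightarrow> 'a \<Rightarrow> real" and p :: real
  assumes compact_C: "compact C" and convex_C: "convex C"
    and separated: "compact_separated (Ext C) d"
    and sym: "x \<in> Ext C \<Longrightarrow> y \<in> Ext C \<Longrightarrow> d x y = d y x"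
    and p: "1 \<le> p"
begin

sublocale compact_separated "Ext C" d by (rule separated)

abbreviation E where "E \<equiv> Ext C"

abbreviation cost :: "('a \<times> 'a) measure \<Rightarrow> real" where
  "cost \<pi> \<equiv> \<integral>w. d (fst w) (snd w) powr p \<partial>\<pi>"

text \<open>Justifies the definite description: a barycenter exists by
  \<open>barycenter_exists\<close> and is unique because continuous forms separate points.\<close>

lemma integral_resultant:
  assumes \<mu>: "\<mu> \<in> radon_prob E"
  shows "resultant C \<mu> \<in> C \<and> (\<forall>f\<in>continuous_dual. (\<integral>z. f z \<partial>\<mu>) = f (resultant C \<mu>))"
proof -
  obtain x where x: "x \<in> C" "\<forall>f\<in>continuous_dual. (\<integral>z. f z \<partial>\<mu>) = f x"
    using barycenter_exists[OF compact_C convex_C Ext_subset compact] \<mu>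
    unfolding radon_prob_iff by blast
  show ?thesis
    unfolding resultant_def
  proof (rule theI[of _ x])
    show "x \<in> C \<and> (\<forall>f\<in>continuous_dual. (\<integral>z. f z \<partial>\<mu>) = f x)" using x by blast
    show "y = x" if "y \<in> C \<and> (\<forall>f\<in>continuous_dual. (\<integral>z. f z \<partial>\<mu>) = f y)" for y
      using that x continuous_dual_separates[of y x] by metis
  qed
qed

lemma resultant_eqI:
  assumes \<mu>: "\<mu> \<in> radon_prob E" and x: "\<forall>f\<in>continuous_dual. (\<integral>z. f z \<partial>\<mu>) = f x"
  shows "resultant C \<mu> = x"
  using integral_resultant[OF \<mu>] x continuous_dual_separates[of "resultant C \<mu>" x] by metis

lemma resultant_fibre_nonempty:
  assumes "x \<in> C"
  shows "resultant_fibre C x \<noteq> {}"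
  using representing_measure_exists[OF compact_C convex_C separated assms] resultant_eqI
  unfolding resultant_fibre_def by blast

lemma resultant_surj: "resultant C ` radon_prob E = C"
  using integral_resultant resultant_fibre_nonempty unfolding resultant_fibre_def by blast

section \<open>Plans and their marginals\<close>

lemma space_plan: "\<pi> \<in> radon_prob (E \<times> E) \<Longrightarrow> space \<pi> = E \<times> E"
  by (auto simp: radon_prob_def space_restrict_space dest: sets_eq_imp_space_eq)

lemma marginals:
  assumes \<pi>: "\<pi> \<in> radon_prob (E \<times> E)"
  shows "fst \<in> measurable \<pi> (restrict_space borel E)" "distr \<pi> (restrict_space borel E) fst \<in> radon_prob E"
    "snd \<in> measurable \<pi> (restrict_space borel E)" "distr \<pi> (restrict_space borel E) snd \<in> radon_prob E"
  by (rule compact_separated.radon_prob_distr[OF compact_separated_Times separated \<pi>];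
      auto intro: continuous_intros)+

lemma dual_measurable:
  "f \<in> continuous_dual \<Longrightarrow> f \<in> borel_measurable (restrict_space borel E)"
  by (intro borel_measurable_continuous_on_restrict continuous_dualD)

lemma integral_marginals:
  assumes \<pi>: "\<pi> \<in> radon_prob (E \<times> E)" and f: "f \<in> continuous_dual"
  shows "(\<integral>z. f z \<partial>distr \<pi> (restrict_space borel E) fst) = (\<integral>w. f (fst w) \<partial>\<pi>)"
    "(\<integral>z. f z \<partial>distr \<pi> (restrict_space borel E) snd) = (\<integral>w. f (snd w) \<partial>\<pi>)"
  using marginals[OF \<pi>] dual_measurable[OF f] by (simp_all add: integral_distr)

lemma bary_plan_coupling:
  assumes "\<pi> \<in> bary_plans C x y"
  obtains \<mu> \<nu> where "\<mu> \<in> resultant_fibre C x" "\<nu> \<in> resultant_fibre C y" "\<pi> \<in> couplings E \<mu> \<nu>"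
proof
  let ?B = "restrict_space borel E"
  have \<pi>: "\<pi> \<in> radon_prob (E \<times> E)"
    and int: "\<forall>f\<in>continuous_dual. (\<integral>w. f (fst w) \<partial>\<pi>) = f x \<and> (\<integral>w. f (snd w) \<partial>\<pi>) = f y"
    using assms by (auto simp: bary_plans_def)
  show "distr \<pi> ?B fst \<in> resultant_fibre C x"
    using marginals(2)[OF \<pi>] int integral_marginals(1)[OF \<pi>]
    by (auto simp: resultant_fibre_def intro: resultant_eqI)
  show "distr \<pi> ?B snd \<in> resultant_fibre C y"
    using marginals(4)[OF \<pi>] int integral_marginals(2)[OF \<pi>]
    by (auto simp: resultant_fibre_def intro: resultant_eqI)
  show "\<pi> \<in> couplings E (distr \<pi> ?B fst) (distr \<pi> ?B snd)"
    using \<pi> by (simp add: couplings_def)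
qed

lemma coupling_bary_plan:
  assumes "\<mu> \<in> resultant_fibre C x" "\<nu> \<in> resultant_fibre C y" "\<pi> \<in> couplings E \<mu> \<nu>"
  shows "\<pi> \<in> bary_plans C x y"
proof -
  have \<pi>: "\<pi> \<in> radon_prob (E \<times> E)" "distr \<pi> (restrict_space borel E) fst = \<mu>"
    "distr \<pi> (restrict_space borel E) snd = \<nu>"
    using assms(3) by (auto simp: couplings_def)
  have "(\<integral>z. f z \<partial>\<mu>) = f x" "(\<integral>z. f z \<partial>\<nu>) = f y" if "f \<in> continuous_dual" for f
    using assms(1,2) integral_resultant that by (auto simp: resultant_fibre_def)
  then show ?thesis
    using \<pi> integral_marginals[OF \<pi>(1)] by (auto simp: bary_plans_def)
qed

text \<open>A real infimum can be bounded below memberwise only over a nonempty set, so the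
  estimates for the roof need this.\<close>

lemma bary_plans_nonempty:
  assumes "x \<in> C" "y \<in> C"
  shows "bary_plans C x y \<noteq> {}"
proof -
  obtain \<mu> \<nu> where \<mu>\<nu>: "\<mu> \<in> resultant_fibre C x" "\<nu> \<in> resultant_fibre C y"
    using resultant_fibre_nonempty assms by blast
  then obtain \<pi> where "\<pi> \<in> couplings E \<mu> \<nu>"
    using couplings_nonempty by (auto simp: resultant_fibre_def)
  then show ?thesis using coupling_bary_plan[OF \<mu>\<nu>] by blast
qed

lemma cost_nonneg: "0 \<le> cost \<pi>"
  by (intro Bochner_Integration.integral_nonneg) simp

lemma bdd_below_cost: "bdd_below (cost ` P)"
  using cost_nonneg by (intro bdd_belowI2)

lemma convex_roof_eq_Inf_wasserstein:
  assumes xy: "x \<in> C" "y \<in> C"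
  shows "convex_roof C d p x y =
    (INF \<mu>\<in>resultant_fibre C x. INF \<nu>\<in>resultant_fibre C y. wasserstein E d p \<mu> \<nu>)"
    (is "_ = (INF \<mu>\<in>?F. INF \<nu>\<in>?G. _)")
proof (rule antisym)
  have W_nonneg: "0 \<le> wasserstein E d p \<mu> \<nu>" for \<mu> \<nu> by (simp add: wasserstein_def)
  have ne: "?F \<noteq> {}" "?G \<noteq> {}" using resultant_fibre_nonempty xy by auto
  have inner: "0 \<le> (INF \<nu>\<in>?G. wasserstein E d p \<mu> \<nu>)" for \<mu>
    using ne(2) W_nonneg by (intro cINF_greatest)
  have Inf_cost_nonneg: "0 \<le> (INF \<pi>\<in>bary_plans C x y. cost \<pi>)"
    using bary_plans_nonempty[OF xy] cost_nonneg by (intro cINF_greatest)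
  show "convex_roof C d p x y \<le> (INF \<mu>\<in>?F. INF \<nu>\<in>?G. wasserstein E d p \<mu> \<nu>)"
  proof (intro cINF_greatest ne)
    fix \<mu> \<nu> assume \<mu>\<nu>: "\<mu> \<in> ?F" "\<nu> \<in> ?G"
    have "couplings E \<mu> \<nu> \<noteq> {}"
      using \<mu>\<nu> couplings_nonempty by (auto simp: resultant_fibre_def)
    \<comment> \<open>Every coupling of measures in the two fibres is an admissible plan, so the
      right-hand infimum runs over a smaller set.\<close>
    then have "(INF \<pi>\<in>bary_plans C x y. cost \<pi>) \<le> (INF \<pi>\<in>couplings E \<mu> \<nu>. cost \<pi>)"
      using coupling_bary_plan[OF \<mu>\<nu>] bdd_below_cost by (intro cINF_superset_mono) auto
    then show "convex_roof C d p x y \<le> wasserstein E d p \<mu> \<nu>"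
      unfolding convex_roof_def wasserstein_def using p Inf_cost_nonneg by (intro powr_mono2) auto
  qed
  define R where "R = (INF \<mu>\<in>?F. INF \<nu>\<in>?G. wasserstein E d p \<mu> \<nu>)"
  have R0: "0 \<le> R" unfolding R_def by (rule cINF_greatest[OF ne(1) inner])
  \<comment> \<open>Raising \<open>R\<close> to the power \<open>p\<close> makes the claim linear in
    the cost, so that the infimum over plans can be taken first and the root once at the end, with
    no minimizer.\<close>
  have "R powr p \<le> cost \<pi>" if \<pi>: "\<pi> \<in> bary_plans C x y" for \<pi>
  proof -
    obtain \<mu> \<nu> where \<mu>\<nu>: "\<mu> \<in> ?F" "\<nu> \<in> ?G" "\<pi> \<in> couplings E \<mu> \<nu>"
      using bary_plan_coupling[OF \<pi>] by blast
    have "R \<le> (INF \<nu>\<in>?G. wasserstein E d p \<mu> \<nu>)"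
      unfolding R_def using inner \<mu>\<nu>(1) by (intro cINF_lower bdd_belowI2[of _ 0])
    also have "\<dots> \<le> wasserstein E d p \<mu> \<nu>"
      using W_nonneg \<mu>\<nu>(2) by (intro cINF_lower bdd_belowI2[of _ 0])
    also have "\<dots> \<le> cost \<pi> powr (1 / p)"
    proof -
      have "0 \<le> (INF \<pi>\<in>couplings E \<mu> \<nu>. cost \<pi>)"
        using \<mu>\<nu>(3) cost_nonneg by (intro cINF_greatest) auto
      moreover have "(INF \<pi>\<in>couplings E \<mu> \<nu>. cost \<pi>) \<le> cost \<pi>"
        by (rule cINF_lower[OF bdd_below_cost \<mu>\<nu>(3)])
      ultimately show ?thesis unfolding wasserstein_def using p by (intro powr_mono2) auto
    qed
    finally have "R powr p \<le> (cost \<pi> powr (1 / p)) powr p"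
      using R0 p by (intro powr_mono2) auto
    then show ?thesis using p cost_nonneg[of \<pi>] by (simp add: powr_powr)
  qed
  then have "R powr p \<le> (INF \<pi>\<in>bary_plans C x y. cost \<pi>)"
    using bary_plans_nonempty[OF xy] by (intro cINF_greatest)
  then have "(R powr p) powr (1 / p) \<le> convex_roof C d p x y"
    unfolding convex_roof_def using p by (intro powr_mono2) auto
  then show "R \<le> convex_roof C d p x y" using p R0 by (simp add: powr_powr)
qed

section \<open>Symmetry of the roof and its zero diagonal\<close>

lemma cost_measurable: "(\<lambda>w. d (fst w) (snd w) powr p) \<in> borel_measurable (restrict_space borel (E \<times> E))"
  using borel_measurable_continuous_on_restrict[OF continuous] by measurable

lemma convex_roof_swap_le:
  assumes xy: "x \<in> C" "y \<in> C"
  shows "convex_roof C d p y x \<le> convex_roof C d p x y"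
proof -
  let ?BB = "restrict_space borel (E \<times> E)"
  have "(INF \<pi>\<in>bary_plans C y x. cost \<pi>) \<le> cost \<pi>" if \<pi>: "\<pi> \<in> bary_plans C x y" for \<pi>
  proof -
    have \<pi>R: "\<pi> \<in> radon_prob (E \<times> E)" using \<pi> by (simp add: bary_plans_def)
    define \<pi>' where "\<pi>' = distr \<pi> ?BB prod.swap"
    have swap: "prod.swap \<in> measurable \<pi> ?BB" "\<pi>' \<in> radon_prob (E \<times> E)"
      unfolding \<pi>'_def
      by (rule compact_separated.radon_prob_distr[OF compact_separated_Times compact_separated_Times \<pi>R];
          auto intro: continuous_on_swap)+
    have meas: "(\<lambda>w. f (fst w)) \<in> borel_measurable ?BB" "(\<lambda>w. f (snd w)) \<in> borel_measurable ?BB"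
      if "f \<in> continuous_dual" for f :: "'a \<Rightarrow> real"
      using continuous_dualD(2)[OF that, of UNIV]
      by (auto intro!: borel_measurable_continuous_on_restrict continuous_intros
          intro: continuous_on_compose2)
    have plan: "\<pi>' \<in> bary_plans C y x"
      using \<pi> swap meas by (auto simp: bary_plans_def \<pi>'_def integral_distr)
    have "cost \<pi>' = cost \<pi>"
    proof -
      have "cost \<pi>' = (\<integral>w. d (snd w) (fst w) powr p \<partial>\<pi>)"
        unfolding \<pi>'_def using swap(1) cost_measurable by (simp add: integral_distr)
      \<comment> \<open>Symmetry of \<open>d\<close> is available on \<open>Ext C\<close> only,
        which suffices because \<open>\<pi>\<close> lives on \<open>E \<times> E\<close>.\<close>
      also have "\<dots> = cost \<pi>"
        using space_plan[OF \<pi>R] by (intro Bochner_Integration.integral_cong) (auto simp: sym)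
      finally show ?thesis .
    qed
    then show ?thesis using cINF_lower[OF bdd_below_cost plan] by simp
  qed
  then have "(INF \<pi>\<in>bary_plans C y x. cost \<pi>) \<le> (INF \<pi>\<in>bary_plans C x y. cost \<pi>)"
    using bary_plans_nonempty[OF xy] by (intro cINF_greatest)
  moreover have "0 \<le> (INF \<pi>\<in>bary_plans C y x. cost \<pi>)"
    using bary_plans_nonempty[OF xy(2,1)] cost_nonneg by (intro cINF_greatest)
  ultimately show ?thesis
    unfolding convex_roof_def using p by (intro powr_mono2) auto
qed

lemma convex_roof_self:
  assumes x: "x \<in> C"
  shows "convex_roof C d p x x = 0"
proof -
  let ?BB = "restrict_space borel (E \<times> E)"
  obtain \<mu> where \<mu>: "\<mu> \<in> radon_prob E" "\<forall>f\<in>continuous_dual. (\<integral>z. f z \<partial>\<mu>) = f x"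
    using representing_measure_exists[OF compact_C convex_C separated x] by blast
  define \<pi> where "\<pi> = distr \<mu> ?BB (\<lambda>e. (e, e))"
  have diag: "(\<lambda>e. (e, e)) \<in> measurable \<mu> ?BB" "\<pi> \<in> radon_prob (E \<times> E)"
    unfolding \<pi>_def
    by (rule radon_prob_distr[OF compact_separated_Times \<mu>(1)]; auto intro: continuous_intros)+
  have spm: "space \<mu> = E"
    using \<mu>(1) by (auto simp: radon_prob_def space_restrict_space dest: sets_eq_imp_space_eq)
  have meas: "(\<lambda>w. f (fst w)) \<in> borel_measurable ?BB" "(\<lambda>w. f (snd w)) \<in> borel_measurable ?BB"
    if "f \<in> continuous_dual" for f :: "'a \<Rightarrow> real"
    using continuous_dualD(2)[OF that, of UNIV]
    by (auto intro!: borel_measurable_continuous_on_restrict continuous_intros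
        intro: continuous_on_compose2)
  have plan: "\<pi> \<in> bary_plans C x x"
    using diag meas \<mu>(2) by (auto simp: bary_plans_def \<pi>_def integral_distr)
  have "cost \<pi> = 0"
  proof -
    have "cost \<pi> = (\<integral>e. d e e powr p \<partial>\<mu>)"
      unfolding \<pi>_def using diag(1) cost_measurable by (simp add: integral_distr)
    \<comment> \<open>Here and for the outer root, \<open>0 powr a = 0\<close> is used.\<close>
    also have "\<dots> = (\<integral>e. 0 \<partial>\<mu>)"
      using spm zero_iff by (intro Bochner_Integration.integral_cong) auto
    finally show ?thesis by simp
  qed
  then have "(INF \<pi>\<in>bary_plans C x x. cost \<pi>) \<le> 0"
    using cINF_lower[OF bdd_below_cost plan] by simp
  moreover have "0 \<le> (INF \<pi>\<in>bary_plans C x x. cost \<pi>)"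
    using bary_plans_nonempty[OF x x] cost_nonneg by (intro cINF_greatest)
  ultimately have "(INF \<pi>\<in>bary_plans C x x. cost \<pi>) = 0" by (rule antisym)
  then show ?thesis unfolding convex_roof_def by simp
qed

lemma chain_distance_largest:
  "largest_pseudo_distance_below C (convex_roof C d p) (chain_distance C d p)"
proof -
  have "chain_distance C d p = (\<lambda>x y. Inf (chain_sums C (convex_roof C d p) x y))"
    by (intro ext) (simp add: chain_distance_def chain_sums_def)
  moreover have "largest_pseudo_distance_below C (convex_roof C d p)
    (\<lambda>x y. Inf (chain_sums C (convex_roof C d p) x y))"
  proof (rule largest_pseudo_distance_below_Inf_chain_sums)
    show "0 \<le> convex_roof C d p x y" for x y by (simp add: convex_roof_def)
    show "convex_roof C d p x y = convex_roof C d p y x" if "x \<in> C" "y \<in> C" for x y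
      using convex_roof_swap_le that by (intro antisym)
    show "convex_roof C d p x x = 0" if "x \<in> C" for x by (rule convex_roof_self[OF that])
  qed
  ultimately show ?thesis by simp
qed

end

theorem proposition1p6:
  fixes C :: "'a::{locally_convex_space, t2_space} set"
    and d :: "'a \<Rightarrow> 'a \<Rightarrow> real"
    and p :: real
  assumes "compact C"
    and "stable_convex C"
    and "Metric_space (Ext C) d"
    and "continuous_on (Ext C \<times> Ext C) (\<lambda>w. d (fst w) (snd w))"
    and "1 \<le> p"
  shows "resultant C ` radon_prob (Ext C) = C \<and>
    (\<forall>x\<in>C. \<forall>y\<in>C. convex_roof C d p x y =
       (INF \<mu>\<in>resultant_fibre C x. INF \<nu>\<in>resultant_fibre C y. wasserstein (Ext C) d p \<mu> \<nu>)) \<and>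
    largest_pseudo_distance_below C (convex_roof C d p) (chain_distance C d p)"
proof -
  interpret d: Metric_space "Ext C" d by fact
  interpret stable_roof C d p
  proof (rule stable_roof.intro)
    show "convex C" using assms(2) by (simp add: stable_convex_def)
    show "compact_separated (Ext C) d"
      using compact_Ext_stable[OF assms(1,2)] assms(4) by unfold_locales auto
    show "d x y = d y x" for x y by (rule d.commute)
  qed (use assms in auto)
  show ?thesis
    using resultant_surj convex_roof_eq_Inf_wasserstein chain_distance_largest by blast
qed

end
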